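(* Let $\tilde{\boldsymbol{b}}=(\tilde b_\nu)_{\nu=1}^N\in(0,\infty)^N$ and let $\tilde{\boldsymbol{c}}=(\tilde{\boldsymbol{c}}^{(\nu)})_{\nu=1}^N$ with $\tilde{\boldsymbol{c}}^{(\nu)}=((\tilde c^{(\nu)}_{i,\nu'})_{i=1}^{m_{\nu'}})_{\nu'=1}^N$, all $\tilde c^{(\nu)}_{i,\nu'}\in(0,\infty)$. Put $\tilde X^{(\tilde{\boldsymbol{c}}^{(\nu)})}=\sum_{\nu'=1}^N\sum_{i=1}^{m_{\nu'}}\tilde c^{(\nu)}_{i,\nu'}X_{i,\nu'}$ for $\nu=1,\dots,N$. With the quantities $\overline{c}_\nu,\tilde C_\nu,A,\underline{\tilde b},\overline{\tilde b},\underline{\overline{\tilde c}},\overline{\overline{\tilde c}},\tilde c_*,\tilde c^*$ as defined in the context, write $$\beta(x)=\overline{\tilde b}+\frac{1}{\tilde c_*x+\underline{\overline{\tilde c}}}\ \ (x\in\mathbb{N}),\qquad \kappa=\frac{\underline{\tilde b}\,\tilde c_*\,\underline{\overline{\tilde c}}}{\overline{\tilde b}\,\tilde c^*\,\overline{\overline{\tilde c}}}.$$ Assume: (a) $\overline{\overline{c}}>0$. (b) $r_\nu\ge\tilde C_\nu+1$ and $r_\nu+\tilde b_\nu\ge\tilde C_\nu+2$ for all $\nu=1,\dots,n$ with $c_{\cdot,\nu}>0$. (c) $\underline{c_\cdot}-A\ge0$. (d) For every $x\in\mathbb{N}$, either (d1) or (d2) holds, where (d1) is the conjunction of: - $\overline{\overline{c}}\beta(x)-2(\underline{r}/\overline{r})^2(\underline{c_\cdot}-A)\kappa\le0$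 implies $\underline{c_\cdot}\beta(x)-2(\underline{r}/\overline{r})^2(\underline{c_\cdot}-A)\kappa\{\underline{r}+\beta(x)\}\le0$; - $\overline{\overline{c}}\beta(x)-2(\underline{r}/\overline{r})^2(\underline{c_\cdot}-A)\kappa>0$ implies $$x\Big[\overline{\overline{c}}\beta(x)-2\Big(\frac{\underline{r}}{\overline{r}}\Big)^2(\underline{c_\cdot}-A)\kappa\Big]+n\underline{c_\cdot}\beta(x)-2n\Big(\frac{\underline{r}}{\overline{r}}\Big)^2(\underline{c_\cdot}-A)\kappa\{\underline{r}+\beta(x)\}\le0;$$ (d2) is the conjunction of: - $\overline{\overline{c}}\beta(x)-2(\underline{c_\cdot}-A)\kappa\le0$ implies $(\underline{c_\cdot}-\overline{\overline{c}}\,\underline{r})-2(\underline{c_\cdot}-A)\kappa\le0$; - $\overline{\overline{c}}\beta(x)-2(\underline{c_\cdot}-A)\kappa>0$ implies $$\Big(\sum_{\nu=1}^nr_\nu+x\Big)\big[\overline{\overline{c}}\beta(x)-2(\underline{c_\cdot}-A)\kappa\big]+n(\underline{c_\cdot}-\overline{\overline{c}}\,\underline{r})\beta(x)-2n(\underline{c_\cdot}-A)\kappa\,\beta(x)\le0.$$ Then the shrinkage estimator $$\hat{\boldsymbol{p}}^{(\tilde{\boldsymbol{b}},\tilde{\boldsymbol{c}})}=\Big(\Big(\frac{X_{i,\nu}}{r_\nu+X_{\cdot,\nu}-1+\tilde b_\nu+1/\tilde X^{(\tilde{\boldsymbol{c}}^{(\nu)})}}\Big)_{i=1}^{m_\nu}\Big)_{\nu=1,\dots,N}$$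 dominates the UMVU estimator $$\hat{\boldsymbol{p}}^{\rm U}=\Big(\Big(\frac{X_{i,\nu}}{r_\nu+X_{\cdot,\nu}-1}\Big)_{i=1}^{m_\nu}\Big)_{\nu=1,\dots,N}$$ of $\boldsymbol{p}$ under the standardized squared error loss $L_{n,\boldsymbol{c}}$.
   Context: Notation: $\mathbb{N}=\{1,2,\dots\}$, $\mathbb{N}_0=\{0,1,2,\dots\}$. Let $N\in\mathbb{N}$, $m_1,\dots,m_N\in\mathbb{N}$, $r_1,\dots,r_N>0$. For $\nu=1,\dots,N$, the unknown parameter vector $\boldsymbol{p}_\nu=(p_{i,\nu})_{i=1}^{m_\nu}$ lies in $D_{m_\nu}=\{(q_1,\dots,q_{m_\nu}) : q_i>0 \ \forall i,\ \sum_i q_i<1\}$, and $p_{0,\nu}=1-\sum_{i=1}^{m_\nu}p_{i,\nu}$. The full parameter is $\boldsymbol{p}=(\boldsymbol{p}_\nu)_{\nu=1}^N\in D=D_{m_1}\times\dots\times D_{m_N}$. The observations $\boldsymbol{X}_\nu=(X_{i,\nu})_{i=1}^{m_\nu}$, $\nu=1,\dots,N$, are independent negative multinomial vectors, $\boldsymbol{X}_\nu$ having probability mass function $$\frac{\Gamma(r_\nu+\sum_{i}x_{i,\nu})}{\Gamma(r_\nu)\prod_{i}x_{i,\nu}!}\,p_{0,\nu}^{r_\nu}\prod_{i=1}^{m_\nu}p_{i,\nu}^{x_{i,\nu}},\qquad (x_{i,\nu})_{i=1}^{m_\nu}\in\mathbb{N}_0^{m_\nu}.$$ Put $X_{\cdot,\nu}=\sum_{i=1}^{m_\nu}X_{i,\nu}$.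 Loss: fix $n\in\{1,\dots,N\}$ and weights $\boldsymbol{c}=((c_{i,\nu})_{i=1}^{m_\nu})_{\nu=1}^N$ with $c_{i,\nu}\in[0,\infty)$. For $\boldsymbol{d}=((d_{i,\nu})_{i=1}^{m_\nu})_{\nu=1}^N$ with real entries, $$L_{n,\boldsymbol{c}}(\boldsymbol{d},\boldsymbol{p})=\sum_{\nu=1}^n\sum_{i=1}^{m_\nu}c_{i,\nu}\frac{(d_{i,\nu}-p_{i,\nu})^2}{p_{i,\nu}}.$$ The risk of an estimator is its expected loss as a function of $\boldsymbol{p}\in D$. An estimator dominates another if its risk is less than or equal to the other's for every $\boldsymbol{p}\in D$, with strict inequality for at least one $\boldsymbol{p}$. Convention: $0/0=0$; when all $X_{i,\nu}=0$ (so that $\tilde X^{(\tilde{\boldsymbol{c}}^{(\nu)})}=0$) the estimator $\hat{\boldsymbol{p}}^{(\tilde{\boldsymbol{b}},\tilde{\boldsymbol{c}})}$ is $0$. Further notation: $\underline{r}=\min_{1\le\nu\le n}r_\nu$, $\overline{r}=\max_{1\le\nu\le n}r_\nu$; $c_{\cdot,\nu}=\sum_{i=1}^{m_\nu}c_{i,\nu}$; $\underline{c_\cdot}=\min_{1\le\nu\le n}c_{\cdot,\nu}$; $\overline{c}_\nu=\max_{1\le i\le m_\nu}c_{i,\nu}$; $\overline{\overline{c}}=\max_{1\le\nu\le n}\overline{c}_\nu$. For $\nu=1,\dots,N$: $\underline{\tilde c}^{(\nu)}_\nu=\min_{1\le i\le m_\nu}\tilde c^{(\nu)}_{i,\nu}$,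 $\overline{\tilde c}^{(\nu)}_\nu=\max_{1\le i\le m_\nu}\tilde c^{(\nu)}_{i,\nu}$, and $$\tilde C_\nu=\frac{\overline{\tilde c}^{(\nu)}_\nu/\underline{\tilde c}^{(\nu)}_\nu}{1+\tilde b_\nu(\underline{\tilde c}^{(\nu)}_\nu+\overline{\tilde c}^{(\nu)}_\nu)}.$$ $A=\max_{1\le\nu\le n}\overline{c}_\nu(\tilde C_\nu+2)$; $\underline{\tilde b}=\min_{1\le\nu\le n}\tilde b_\nu$, $\overline{\tilde b}=\max_{1\le\nu\le n}\tilde b_\nu$; $\underline{\overline{\tilde c}}=\min_{1\le\nu\le n}\overline{\tilde c}^{(\nu)}_\nu$, $\overline{\overline{\tilde c}}=\max_{1\le\nu\le n}\overline{\tilde c}^{(\nu)}_\nu$; $\tilde c_*=\min_{1\le\nu\le N}\min_{1\le\nu'\le N}\min_{1\le i\le m_{\nu'}}\tilde c^{(\nu)}_{i,\nu'}$ and $\tilde c^*=\max_{1\le\nu\le N}\max_{1\le\nu'\le N}\max_{1\le i\le m_{\nu'}}\tilde c^{(\nu)}_{i,\nu'}$. *)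

theory Defs
  imports "HOL-Probability.Probability"
begin

text \<open>Vectors with 1-based indices are functions on \<open>nat\<close>. For doubly indexed families the
  population index comes first: \<open>p \<nu> i\<close> stands for \<open>p\<^sub>i\<^sub>,\<^sub>\<nu>\<close>, and \<open>ct \<nu> \<nu>' i\<close> for the
  \<open>(i, \<nu>')\<close> entry of the \<open>\<nu>\<close>-th weight array.\<close>

definition open_simplex :: "nat \<Rightarrow> (nat \<Rightarrow> real) set" where
  "open_simplex m = {q \<in> {1..m} \<rightarrow>\<^sub>E {0<..}. (\<Sum>i=1..m. q i) < 1}"

definition param_space :: "nat \<Rightarrow> (nat \<Rightarrow> nat) \<Rightarrow> (nat \<Rightarrow> nat \<Rightarrow> real) set" where
  "param_space N m = (\<Pi>\<^sub>E \<nu>\<in>{1..N}. open_simplex (m \<nu>))"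

definition count_vectors :: "nat \<Rightarrow> (nat \<Rightarrow> nat) set" where
  "count_vectors m = {1..m} \<rightarrow>\<^sub>E UNIV"

definition neg_multinomial_mass :: "nat \<Rightarrow> real \<Rightarrow> (nat \<Rightarrow> real) \<Rightarrow> (nat \<Rightarrow> nat) \<Rightarrow> real" where
  "neg_multinomial_mass m s q x =
     Gamma (s + (\<Sum>i=1..m. real (x i))) / (Gamma s * (\<Prod>i=1..m. fact (x i)))
       * (1 - (\<Sum>i=1..m. q i)) powr s * (\<Prod>i=1..m. q i ^ x i)"

text \<open>A statistical model \<open>(M p)\<close>, \<open>p\<close> in the parameter space, with observations \<open>X 1, ..., X N\<close>.
  A density with respect to counting measure is a probability mass function.\<close>

definition neg_multinomial_model ::
  "nat \<Rightarrow> (nat \<Rightarrow> nat) \<Rightarrow> (nat \<Rightarrow> real) \<Rightarrow> ((nat \<Rightarrow> nat \<Rightarrow> real) \<Rightarrow> 'w measure)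
    \<Rightarrow> (nat \<Rightarrow> 'w \<Rightarrow> nat \<Rightarrow> nat) \<Rightarrow> bool" where
  "neg_multinomial_model N m r M X \<longleftrightarrow>
     (\<forall>p\<in>param_space N m.
        prob_space (M p) \<and>
        prob_space.indep_vars (M p) (\<lambda>\<nu>. count_space (count_vectors (m \<nu>))) X {1..N} \<and>
        (\<forall>\<nu>\<in>{1..N}. distributed (M p) (count_space (count_vectors (m \<nu>))) (X \<nu>)
            (\<lambda>x. ennreal (neg_multinomial_mass (m \<nu>) (r \<nu>) (p \<nu>) x))))"

definition std_sq_loss ::
  "(nat \<Rightarrow> nat) \<Rightarrow> nat \<Rightarrow> (nat \<Rightarrow> nat \<Rightarrow> real) \<Rightarrow> (nat \<Rightarrow> nat \<Rightarrow> real) \<Rightarrow> (nat \<Rightarrow> nat \<Rightarrow> real) \<Rightarrow> real" where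
  "std_sq_loss m n c d p = (\<Sum>\<nu>=1..n. \<Sum>i=1..m \<nu>. c \<nu> i * ((d \<nu> i - p \<nu> i)\<^sup>2 / p \<nu> i))"

text \<open>An estimator maps the data \<open>x\<close>, with \<open>x \<nu> i\<close> the observed counts, to an estimate of \<open>p\<close>.
  The loss is nonnegative, so its expectation is taken in the extended nonnegative reals.\<close>

type_synonym estimator = "(nat \<Rightarrow> nat \<Rightarrow> nat) \<Rightarrow> nat \<Rightarrow> nat \<Rightarrow> real"

definition risk ::
  "((nat \<Rightarrow> nat \<Rightarrow> real) \<Rightarrow> 'w measure) \<Rightarrow> (nat \<Rightarrow> 'w \<Rightarrow> nat \<Rightarrow> nat)
    \<Rightarrow> ((nat \<Rightarrow> nat \<Rightarrow> real) \<Rightarrow> (nat \<Rightarrow> nat \<Rightarrow> real) \<Rightarrow> real) \<Rightarrow> estimator \<Rightarrow> (nat \<Rightarrow> nat \<Rightarrow> real) \<Rightarrow> ennreal" where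
  "risk M X L \<delta> p = (\<integral>\<^sup>+ \<omega>. ennreal (L (\<delta> (\<lambda>\<nu>. X \<nu> \<omega>)) p) \<partial>M p)"

definition dominates :: "'p set \<Rightarrow> ('e \<Rightarrow> 'p \<Rightarrow> ennreal) \<Rightarrow> 'e \<Rightarrow> 'e \<Rightarrow> bool" where
  "dominates P R \<delta> \<delta>' \<longleftrightarrow> (\<forall>p\<in>P. R \<delta> p \<le> R \<delta>' p) \<and> (\<exists>p\<in>P. R \<delta> p < R \<delta>' p)"

text \<open>Division by zero yields zero here, which agrees with the convention \<open>0/0 = 0\<close>: in both
  estimators below a zero divisor, or an inner term \<open>1/0\<close>, occurs only with numerator zero
  (as long as \<open>r \<nu>\<close>, \<open>b \<nu>\<close> and the weights \<open>ct\<close> are positive).\<close>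

definition umvu_estimator :: "(nat \<Rightarrow> nat) \<Rightarrow> (nat \<Rightarrow> real) \<Rightarrow> estimator" where
  "umvu_estimator m r x \<nu> i = real (x \<nu> i) / (r \<nu> + (\<Sum>j=1..m \<nu>. real (x \<nu> j)) - 1)"

definition shrinkage_estimator ::
  "nat \<Rightarrow> (nat \<Rightarrow> nat) \<Rightarrow> (nat \<Rightarrow> real) \<Rightarrow> (nat \<Rightarrow> real) \<Rightarrow> (nat \<Rightarrow> nat \<Rightarrow> nat \<Rightarrow> real) \<Rightarrow> estimator" where
  "shrinkage_estimator N m r b ct x \<nu> i =
     real (x \<nu> i) /
       (r \<nu> + (\<Sum>j=1..m \<nu>. real (x \<nu> j)) - 1 + b \<nu>
         + 1 / (\<Sum>\<nu>'=1..N. \<Sum>j=1..m \<nu>'. ct \<nu> \<nu>' j * real (x \<nu>' j)))"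

end

theory Submission
  imports Defs
begin

text \<open>The risk of any estimator of the form
  \<open>X\<nu>i / (r\<nu> + X.\<nu> - 1 + h\<nu>(X))\<close> with \<open>h \<ge> 0\<close> and \<open>r > 1\<close> has, up to a term that does not involve
  the estimator, an unbiased estimate \<open>U h\<close> in which the parameter no longer occurs. It comes from the
  negative multinomial analogue of Stein's identity,
  \<open>E[F(X) / p\<nu>i] = E[F(X + e\<nu>i) (r\<nu> + X.\<nu>) / (X\<nu>i + 1)]\<close> whenever \<open>F\<close> vanishes at \<open>X\<nu>i = 0\<close>,
  which is nothing but the ratio of the mass function at neighbouring points
  (\<open>joint_mass_increment\<close>, \<open>expected_loss_eq_unbiased_risk\<close>). The UMVU estimator is the case
  \<open>h = 0\<close>, the shrinkage estimator the case \<open>h\<nu> = b\<nu> + 1 / X~\<nu>\<close>. Dominance therefore follows from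
  the pointwise inequality \<open>U h \<le> U 0\<close>, which is strict at the outcome where all counts vanish,
  an outcome of positive probability.

  Write \<open>s = r\<nu> + y\<nu>\<close> with \<open>y\<nu> = X.\<nu>\<close>, and let \<open>\<psi>\<nu>\<close> be \<open>h\<nu>\<close> with \<open>X~\<nu>\<close> raised by the largest
  weight of population \<open>\<nu>\<close>. This is a lower bound for every \<open>h\<nu>(X + e\<nu>i)\<close>, and it is close
  to \<open>h\<nu>(X)\<close> as well: \<open>\<psi>\<nu> \<le> h\<nu>(X) \<le> \<psi>\<nu> (1 + C\<nu> / y\<nu>)\<close> if \<open>y\<nu> > 0\<close>
  (\<open>inverse_affine_ratio\<close>). With the lower bounds on \<open>r\<nu>\<close> and
  \<open>r\<nu> + b\<nu>\<close>, the contribution of population \<open>\<nu>\<close> to \<open>U h - U 0\<close> is at most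
  \<open>\<psi> / (s (s + \<psi>)) * ((c* y + c) \<psi> / (s + \<psi>) - 2 (c - A))\<close>, where \<open>c*\<close> is the largest single weight
  of the loss and \<open>c\<close> the smallest weight sum
  (\<open>population_bound\<close>). Finally \<open>\<kappa> \<beta> \<le> \<psi>\<nu> \<le> \<beta>\<close> (\<open>shrinkage_term_ge\<close>) removes the dependence of \<open>\<psi>\<close>
  on the population. What remains is a sum of products of a decreasing weight and an affine function,
  of \<open>y\<nu>\<close> under the first alternative and of \<open>s\<close> under the second one. If that function is not
  increasing, the alternative makes every summand nonpositive; if it is increasing, Chebyshev's sum
  inequality shows that it suffices for the affine functions to have nonpositive sum
  (\<open>reduced_sum_nonpos\<close>).\<close>

section \<open>Inequalities for a single population\<close>

text \<open>Passing from \<open>s - 1\<close> to \<open>s\<close> in both factors of the denominator costs \<open>(t + 1) / t\<close> and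
  \<open>(t + 2) / (t + 1)\<close> with \<open>t = y + C\<close>; these are exactly what the lower bounds on \<open>r\<close> and \<open>r + b\<close> allow.
  Together with the factor \<open>t / y\<close> between \<open>\<phi>\<close> and \<open>\<psi>\<close> the product telescopes to \<open>(t + 2) / y\<close>.\<close>
lemma umvu_shift_bound:
  fixes C y r s b \<psi> \<phi> :: real
  assumes "0 \<le> C" "0 < y" "s = r + y" "C + 1 \<le> r" "C + 2 \<le> r + b"
    "b \<le> \<psi>" "0 < \<psi>" "\<psi> \<le> \<phi>" "\<phi> \<le> \<psi> * (1 + C / y)"
  shows "1 / (s - 1) - 1 / (s - 1 + \<phi>) \<le> (1 + (C + 2) / y) * (\<psi> / (s * (s + \<psi>)))"
proof -
  define t where "t = y + C"
  define u where "u = s - 1"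
  define v where "v = s - 1 + \<psi>"
  have pos: "0 < t" "t \<le> u" "t + 1 \<le> v" "0 < u" "0 < v"
    using assms by (auto simp: t_def u_def v_def)
  have "t * (u + 1) * (v + 1) \<le> (t + 1) * u * (v + 1)"
    using pos by (intro mult_right_mono) (auto simp: algebra_simps)
  also have "\<dots> = u * ((t + 1) * (v + 1))" by (simp add: algebra_simps)
  also have "\<dots> \<le> u * ((t + 2) * v)"
    using pos by (intro mult_left_mono) (auto simp: algebra_simps)
  finally have key: "t * ((u + 1) * (v + 1)) \<le> (t + 2) * (u * v)"
    by (simp add: algebra_simps)
  have "1 / (s - 1) - 1 / (s - 1 + \<phi>) = \<phi> / (u * (u + \<phi>))"
    using pos assms by (auto simp: u_def field_simps)
  also have "\<dots> \<le> \<psi> * (1 + C / y) / (u * v)"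
    using pos assms by (intro frac_le mult_left_mono) (auto simp: u_def v_def)
  also have "\<dots> = \<psi> / y * (t / (u * v))"
    using assms by (simp add: t_def field_simps)
  also have "\<dots> \<le> \<psi> / y * ((t + 2) / ((u + 1) * (v + 1)))"
    using key pos assms by (intro mult_left_mono) (auto simp: divide_simps)
  also have "\<dots> = (1 + (C + 2) / y) * (\<psi> / (s * (s + \<psi>)))"
    using assms by (simp add: t_def u_def v_def field_simps)
  finally show ?thesis .
qed

text \<open>The left-hand side is decreasing in \<open>\<phi>\<close>, and at \<open>\<phi> = \<psi>\<close> the two sides agree.\<close>
lemma squared_term_bound:
  fixes s \<psi> \<phi> :: real
  assumes "0 < s" "0 < \<psi>" "\<psi> \<le> \<phi>"
  shows "s / (s + \<phi>)\<^sup>2 - 1 / s \<le> - (\<psi> / (s * (s + \<psi>)) * (2 - \<psi> / (s + \<psi>)))"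
proof -
  have "s / (s + \<phi>)\<^sup>2 \<le> s / (s + \<psi>)\<^sup>2"
    using assms by (intro divide_left_mono power_mono) auto
  also have "s / (s + \<psi>)\<^sup>2 = 1 / s - \<psi> / (s * (s + \<psi>)) * (2 - \<psi> / (s + \<psi>))"
  proof -
    have "s + \<psi> \<noteq> 0" "s \<noteq> 0" using assms by auto
    then show ?thesis by (simp add: divide_simps power2_eq_square) (simp add: algebra_simps)
  qed
  finally show ?thesis by simp
qed

text \<open>The quotient of the two values of \<open>b + 1 / _\<close> is exactly
  \<open>1 + ct / (X (1 + b (X + ct)))\<close>. Here the first \<open>X\<close> is at least \<open>ct_lo * y\<close> and the second one
  at least \<open>ct_lo\<close>.\<close>
lemma inverse_affine_ratio:
  fixes b ct ct_lo X y :: real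
  assumes "0 < b" "0 < ct_lo" "ct_lo \<le> ct" "1 \<le> y" "ct_lo * y \<le> X"
  shows "b + 1 / X \<le> (b + 1 / (X + ct)) * (1 + ct / ct_lo / (1 + b * (ct_lo + ct)) / y)"
proof -
  have y: "ct_lo \<le> ct_lo * y" using assms by simp
  then have X: "0 < X" "ct_lo \<le> X" using assms by linarith+
  have "ct / (X * (1 + b * (X + ct))) \<le> ct / ((ct_lo * y) * (1 + b * (ct_lo + ct)))"
    using assms X by (intro divide_left_mono mult_mono mult_pos_pos add_left_mono add_pos_pos) auto
  also have "\<dots> = ct / ct_lo / (1 + b * (ct_lo + ct)) / y" by simp
  finally have le: "ct / (X * (1 + b * (X + ct))) \<le> \<dots>" .
  have nz: "1 + b * (X + ct) > 0" "X + ct > 0"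
    using assms X by (auto intro!: add_pos_pos mult_pos_pos)
  have "b + 1 / X = (b + 1 / (X + ct)) * (1 + ct / (X * (1 + b * (X + ct))))"
  proof -
    have 1: "b + 1 / (X + ct) = (1 + b * (X + ct)) / (X + ct)"
      using nz by (simp add: field_simps)
    have 2: "1 + ct / (X * (1 + b * (X + ct))) = (X * (1 + b * (X + ct)) + ct) / (X * (1 + b * (X + ct)))"
      using nz X by (simp add: add_divide_distrib)
    have 3: "X * (1 + b * (X + ct)) + ct = (X + ct) * (1 + b * X)" by (simp add: algebra_simps)
    have "(b + 1 / (X + ct)) * (1 + ct / (X * (1 + b * (X + ct))))
       = ((1 + b * (X + ct)) / (X + ct)) * (((X + ct) * (1 + b * X)) / (X * (1 + b * (X + ct))))"
      by (simp only: 1 2 3)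
    also have "\<dots> = (1 + b * X) / X" using nz by simp
    also have "\<dots> = b + 1 / X" using X by (simp add: field_simps)
    finally show ?thesis by simp
  qed
  also have "\<dots> \<le> (b + 1 / (X + ct)) * (1 + ct / ct_lo / (1 + b * (ct_lo + ct)) / y)"
    using le nz assms by (intro mult_left_mono add_left_mono add_nonneg_nonneg) auto
  finally show ?thesis .
qed

text \<open>The contribution of one population to the difference of the unbiased risks. The counts are
  \<open>x\<close> with sum \<open>y\<close>, the shrinkage term is \<open>\<phi>\<close> at the observation and \<open>\<phi>e i\<close> after raising the
  \<open>i\<close>-th count. Both parts are first expressed through the common lower bound \<open>\<psi>\<close>; after that the
  terms \<open>2 * (\<Sum>c x)\<close> cancel, and what is left of the leading order is \<open>A\<close> against the
  weight sum.\<close>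
lemma population_bound:
  fixes c x :: "nat \<Rightarrow> real" and \<phi>e :: "nat \<Rightarrow> real"
  assumes c: "\<And>i. i \<in> J \<Longrightarrow> 0 \<le> c i" "\<And>i. i \<in> J \<Longrightarrow> c i \<le> cmax"
    and x: "\<And>i. i \<in> J \<Longrightarrow> 0 \<le> x i" and y: "y = (\<Sum>i\<in>J. x i)" and s: "s = r + y"
    and C: "0 \<le> C" "C + 1 \<le> r" "C + 2 \<le> r + b"
    and \<psi>: "b \<le> \<psi>" "0 < \<psi>" "\<And>i. i \<in> J \<Longrightarrow> \<psi> \<le> \<phi>e i"
    and \<phi>: "0 < y \<Longrightarrow> \<psi> \<le> \<phi> \<and> \<phi> \<le> \<psi> * (1 + C / y)"
    and cC: "cmax \<le> Cmax" and cA: "cmax * (C + 2) \<le> A" and A: "0 \<le> A" and fin: "finite J"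
    and cm: "cm \<le> (\<Sum>i\<in>J. c i)"
  shows "(\<Sum>i\<in>J. c i * ((x i + 1) * (s / (s + \<phi>e i)\<^sup>2 - 1 / s)
             + 2 * x i * (1 / (s - 1) - 1 / (s - 1 + \<phi>))))
       \<le> \<psi> / (s * (s + \<psi>)) * ((Cmax * y + cm) * (\<psi> / (s + \<psi>)) - 2 * (cm - A))"
proof -
  define k where "k = \<psi> / (s * (s + \<psi>))"
  define q where "q = \<psi> / (s + \<psi>)"
  define cx where "cx = (\<Sum>i\<in>J. c i * x i)"
  have y0: "0 \<le> y" using x y by (auto intro: sum_nonneg)
  have s0: "0 < s" using y0 C s by linarith
  have k0: "0 \<le> k" and q0: "0 \<le> q" "q \<le> 1" using s0 \<psi> by (auto simp: k_def q_def)
  have cx0: "0 \<le> cx" using c x by (auto simp: cx_def intro!: sum_nonneg)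
  have cxy: "cx \<le> cmax * y"
    unfolding cx_def y sum_distrib_left using c x by (intro sum_mono mult_right_mono) auto
  have lin: "cx * (1 / (s - 1) - 1 / (s - 1 + \<phi>)) \<le> k * (cx + A)"
  proof (cases "y = 0")
    case True
    then have "cx = 0" using cxy cx0 by simp
    then show ?thesis using k0 A by simp
  next
    case False
    then have "0 < y" using y0 by simp
    have "1 / (s - 1) - 1 / (s - 1 + \<phi>) \<le> (1 + (C + 2) / y) * k"
      unfolding k_def using umvu_shift_bound [of C y s r b \<psi> \<phi>] C \<psi> \<phi> \<open>0 < y\<close> s by simp
    then have "cx * (1 / (s - 1) - 1 / (s - 1 + \<phi>)) \<le> cx * ((1 + (C + 2) / y) * k)"
      using cx0 by (rule mult_left_mono)
    also have "\<dots> = k * (cx + cx / y * (C + 2))" by (simp add: algebra_simps add_divide_distrib)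
    also have "\<dots> \<le> k * (cx + cmax * (C + 2))"
      using k0 cxy \<open>0 < y\<close> C by (intro mult_left_mono add_left_mono mult_right_mono) (auto simp: field_simps)
    also have "\<dots> \<le> k * (cx + A)" using k0 cA by (intro mult_left_mono) auto
    finally show ?thesis .
  qed
  have "(\<Sum>i\<in>J. c i * ((x i + 1) * (s / (s + \<phi>e i)\<^sup>2 - 1 / s)
             + 2 * x i * (1 / (s - 1) - 1 / (s - 1 + \<phi>))))
      \<le> (\<Sum>i\<in>J. c i * ((x i + 1) * - (k * (2 - q)) + 2 * x i * (1 / (s - 1) - 1 / (s - 1 + \<phi>))))"
    unfolding k_def q_def using c x s0 \<psi>
    by (intro sum_mono mult_left_mono add_right_mono squared_term_bound) (auto simp: add_nonneg_nonneg)
  also have "\<dots> = - (k * (2 - q)) * (cx + (\<Sum>i\<in>J. c i)) + 2 * (cx * (1 / (s - 1) - 1 / (s - 1 + \<phi>)))"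
  proof -
    have *: "c i * ((x i + 1) * - K + 2 * x i * L) = - K * (c i * x i) + - K * c i + 2 * L * (c i * x i)"
      for i K L by (simp add: algebra_simps)
    show ?thesis unfolding * sum.distrib sum_distrib_left [symmetric] cx_def by (simp add: algebra_simps)
  qed
  also have "\<dots> \<le> - (k * (2 - q)) * (cx + cm) + 2 * (k * (cx + A))"
  proof -
    have "k * (2 - q) * (cx + cm) \<le> k * (2 - q) * (cx + (\<Sum>i\<in>J. c i))"
      using cm k0 q0 by (intro mult_left_mono) auto
    then show ?thesis using lin by simp
  qed
  also have "\<dots> = k * ((cx + cm) * q - 2 * (cm - A))" by (simp add: algebra_simps)
  also have "\<dots> \<le> k * ((Cmax * y + cm) * q - 2 * (cm - A))"
  proof -
    have "cx \<le> Cmax * y" using cxy mult_right_mono [OF cC y0] by linarith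
    then show ?thesis using k0 q0
      by (intro mult_left_mono diff_right_mono mult_right_mono) auto
  qed
  finally show ?thesis unfolding k_def q_def .
qed

section \<open>Combining the populations\<close>

text \<open>This is Chebyshev's sum inequality: the double sum of \<open>(W i - W j) * (G i - G j)\<close>
  is twice the difference of \<open>card I * (\<Sum>W G)\<close> and \<open>(\<Sum>W) (\<Sum>G)\<close>.\<close>
lemma sum_mult_nonpos_if_oppositely_ordered:
  fixes W G :: "'i \<Rightarrow> real"
  assumes fin: "finite I"
    and ord: "\<And>i j. i \<in> I \<Longrightarrow> j \<in> I \<Longrightarrow> (W i - W j) * (G i - G j) \<le> 0"
    and W: "\<And>i. i \<in> I \<Longrightarrow> 0 \<le> W i"
    and G: "(\<Sum>i\<in>I. G i) \<le> 0"
  shows "(\<Sum>i\<in>I. W i * G i) \<le> 0"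
proof (cases "I = {}")
  case False
  have "0 \<ge> (\<Sum>i\<in>I. \<Sum>j\<in>I. (W i - W j) * (G i - G j))"
    by (intro sum_nonpos ord)
  also have "(\<Sum>i\<in>I. \<Sum>j\<in>I. (W i - W j) * (G i - G j))
      = (\<Sum>i\<in>I. \<Sum>j\<in>I. W i * G i) - (\<Sum>i\<in>I. \<Sum>j\<in>I. W i * G j)
        - (\<Sum>i\<in>I. \<Sum>j\<in>I. W j * G i) + (\<Sum>i\<in>I. \<Sum>j\<in>I. W j * G j)"
    by (simp only: left_diff_distrib right_diff_distrib sum_subtractf)
  also have "(\<Sum>i\<in>I. \<Sum>j\<in>I. W i * G i) = real (card I) * (\<Sum>i\<in>I. W i * G i)"
    by (simp add: sum_distrib_left)
  also have "(\<Sum>i\<in>I. \<Sum>j\<in>I. W i * G j) = (\<Sum>i\<in>I. W i) * (\<Sum>i\<in>I. G i)"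
    by (simp add: sum_product)
  also have "(\<Sum>i\<in>I. \<Sum>j\<in>I. W j * G i) = (\<Sum>i\<in>I. W i) * (\<Sum>i\<in>I. G i)"
    by (subst sum.swap) (simp add: sum_product)
  finally have "real (card I) * (\<Sum>i\<in>I. W i * G i) \<le> (\<Sum>i\<in>I. W i) * (\<Sum>i\<in>I. G i)"
    by (simp add: mult.commute)
  also have "\<dots> \<le> 0"
    using G W by (intro mult_nonneg_nonpos sum_nonneg) auto
  finally show ?thesis
    using False fin by (simp add: mult_le_0_iff card_gt_0_iff)
qed simp

text \<open>Replacing \<open>\<psi>\<close> by \<open>\<beta>\<close>, except in the numerator of the negative part, where it becomes
  \<open>\<kappa> * \<beta>\<close>, leaves
  \<open>\<beta> * w s * ((C y + cm) \<beta> - 2 D \<kappa> (s + \<beta>))\<close> with the decreasing weight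
  \<open>w s = 1 / (s (s + \<beta>)\<^sup>2)\<close>. The two alternatives of the hypothesis are two ways of bringing
  this into a form to which Chebyshev's inequality applies. The first one makes all \<open>r \<nu>\<close> equal to \<open>r_min\<close>,
  at the price of the factor \<open>(r_min / r_max)\<^sup>2\<close> in the negative part, so that \<open>y\<close> is the only
  variable. The second one keeps the weights and writes the bracket as a function of
  \<open>s = r + y\<close>.\<close>
lemma reduced_sum_nonpos:
  fixes r y \<psi> :: "'i \<Rightarrow> real"
  assumes fin: "finite I"
    and r: "0 < r_min" "\<And>\<nu>. \<nu> \<in> I \<Longrightarrow> r_min \<le> r \<nu>" "\<And>\<nu>. \<nu> \<in> I \<Longrightarrow> r \<nu> \<le> r_max" "r_min \<le> r_max"
    and y: "\<And>\<nu>. \<nu> \<in> I \<Longrightarrow> 0 \<le> y \<nu>" "(\<Sum>\<nu>\<in>I. y \<nu>) \<le> x"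
    and \<kappa>: "0 < \<kappa>" and \<beta>: "0 < \<beta>"
    and \<psi>: "\<And>\<nu>. \<nu> \<in> I \<Longrightarrow> \<kappa> * \<beta> \<le> \<psi> \<nu>" "\<And>\<nu>. \<nu> \<in> I \<Longrightarrow> \<psi> \<nu> \<le> \<beta>"
    and c: "0 \<le> C" "0 \<le> cm" "0 \<le> D"
    and d: "((C * \<beta> - 2 * (r_min / r_max)\<^sup>2 * D * \<kappa> \<le> 0 \<longrightarrow>
           cm * \<beta> - 2 * (r_min / r_max)\<^sup>2 * D * \<kappa> * (r_min + \<beta>) \<le> 0) \<and>
        (C * \<beta> - 2 * (r_min / r_max)\<^sup>2 * D * \<kappa> > 0 \<longrightarrow>
           x * (C * \<beta> - 2 * (r_min / r_max)\<^sup>2 * D * \<kappa>)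
             + real (card I) * cm * \<beta>
             - 2 * real (card I) * (r_min / r_max)\<^sup>2 * D * \<kappa> * (r_min + \<beta>) \<le> 0))
       \<or>
       ((C * \<beta> - 2 * D * \<kappa> \<le> 0 \<longrightarrow> (cm - C * r_min) - 2 * D * \<kappa> \<le> 0) \<and>
        (C * \<beta> - 2 * D * \<kappa> > 0 \<longrightarrow>
           ((\<Sum>\<nu>\<in>I. r \<nu>) + x) * (C * \<beta> - 2 * D * \<kappa>)
             + real (card I) * (cm - C * r_min) * \<beta>
             - 2 * real (card I) * D * \<kappa> * \<beta> \<le> 0))" (is "(?d11 \<and> ?d12) \<or> (?d21 \<and> ?d22)")
  shows "(\<Sum>\<nu>\<in>I. \<psi> \<nu> / ((r \<nu> + y \<nu>) * (r \<nu> + y \<nu> + \<psi> \<nu>))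
            * ((C * y \<nu> + cm) * (\<psi> \<nu> / (r \<nu> + y \<nu> + \<psi> \<nu>)) - 2 * D)) \<le> 0"
proof -
  define w where "w s = 1 / (s * (s + \<beta>)\<^sup>2)" for s :: real
  have w0: "0 \<le> w s" if "0 < s" for s using that \<beta> by (simp add: w_def)
  have w_mono: "w t \<le> w s" if "0 < s" "s \<le> t" for s t
    unfolding w_def using that \<beta> by (intro divide_left_mono mult_mono power_mono mult_pos_pos) auto
  define \<rho> where "\<rho> = (r_min / r_max)\<^sup>2"
  have rmax0: "0 < r_max" using r by linarith
  have \<rho>: "0 \<le> \<rho>" "\<rho> \<le> 1" using r rmax0 by (auto simp: \<rho>_def power_le_one)
  have s0: "0 < r \<nu> + y \<nu>" "r_min \<le> r \<nu> + y \<nu>" if "\<nu> \<in> I" for \<nu>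
    using r(1) r(2)[OF that] y(1)[OF that] by auto
  have term_le: "\<psi> \<nu> / ((r \<nu> + y \<nu>) * (r \<nu> + y \<nu> + \<psi> \<nu>))
            * ((C * y \<nu> + cm) * (\<psi> \<nu> / (r \<nu> + y \<nu> + \<psi> \<nu>)) - 2 * D)
       \<le> \<beta> * (w (r \<nu> + y \<nu>) * ((C * y \<nu> + cm) * \<beta> - 2 * D * \<kappa> * (r \<nu> + y \<nu> + \<beta>)))"
    if \<nu>: "\<nu> \<in> I" for \<nu>
  proof -
    define s where "s = r \<nu> + y \<nu>"
    define p where "p = \<psi> \<nu>"
    have s: "0 < s" using s0 \<nu> by (simp add: s_def)
    have p: "\<kappa> * \<beta> \<le> p" "p \<le> \<beta>" "0 < \<kappa> * \<beta>" using \<psi> \<nu> \<kappa> \<beta> by (auto simp: p_def)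
    then have p0: "0 < p" by linarith
    have q: "p / (s + p) \<le> \<beta> / (s + \<beta>)" using s p0 p by (simp add: field_simps)
    have Cy: "0 \<le> C * y \<nu> + cm" using c y \<nu> by auto
    have "p / (s * (s + p)) * ((C * y \<nu> + cm) * (p / (s + p)))
        = (C * y \<nu> + cm) * ((p / (s + p))\<^sup>2 / s)"
      by (simp add: power2_eq_square mult_ac)
    also have "\<dots> \<le> (C * y \<nu> + cm) * ((\<beta> / (s + \<beta>))\<^sup>2 / s)"
      using q s p0 Cy by (intro mult_left_mono divide_right_mono power_mono) auto
    also have "\<dots> = \<beta> * (w s * ((C * y \<nu> + cm) * \<beta>))"
      by (simp add: w_def power2_eq_square mult_ac)
    finally have 1: "p / (s * (s + p)) * ((C * y \<nu> + cm) * (p / (s + p))) \<le> \<dots>" .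
    have "\<beta> * (w s * (2 * D * \<kappa> * (s + \<beta>))) = 2 * D * (\<kappa> * \<beta> / (s * (s + \<beta>)))"
      using s \<beta> by (simp add: w_def power2_eq_square)
    also have "\<dots> \<le> 2 * D * (p / (s * (s + p)))"
      using p p0 s c by (intro mult_left_mono frac_le) auto
    finally have 2: "\<beta> * (w s * (2 * D * \<kappa> * (s + \<beta>))) \<le> p / (s * (s + p)) * (2 * D)"
      by (simp add: mult.commute)
    show ?thesis using 1 2 unfolding s_def [symmetric] p_def [symmetric] right_diff_distrib
      by linarith
  qed
  have "(\<Sum>\<nu>\<in>I. w (r \<nu> + y \<nu>) * ((C * y \<nu> + cm) * \<beta> - 2 * D * \<kappa> * (r \<nu> + y \<nu> + \<beta>))) \<le> 0"
    using d
  proof (elim disjE conjE)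
    assume d11: ?d11 and d12: ?d12
    \<comment> \<open>Positive part: \<open>w\<close> is decreasing. Negative part: \<open>s / t \<le> r_max / r_min\<close>, used for each of the two factors.\<close>
    have le: "w (r \<nu> + y \<nu>) * ((C * y \<nu> + cm) * \<beta> - 2 * D * \<kappa> * (r \<nu> + y \<nu> + \<beta>))
        \<le> w (r_min + y \<nu>) * ((C * \<beta> - 2 * \<rho> * D * \<kappa>) * y \<nu> + (cm * \<beta> - 2 * \<rho> * D * \<kappa> * (r_min + \<beta>)))"
      if \<nu>: "\<nu> \<in> I" for \<nu>
    proof -
      define t where "t = r_min + y \<nu>"
      define s where "s = r \<nu> + y \<nu>"
      have t: "0 < t" "t \<le> s" using r y \<nu> by (auto simp: t_def s_def add_pos_nonneg)
      have "w s * ((C * y \<nu> + cm) * \<beta>) \<le> w t * ((C * y \<nu> + cm) * \<beta>)"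
        using w_mono t c y \<nu> \<beta> by (intro mult_right_mono) auto
      moreover have "\<rho> * (w t * (t + \<beta>)) \<le> w s * (s + \<beta>)"
      proof -
        have st: "s * r_min \<le> t * r_max"
        proof -
          have "r \<nu> * r_min \<le> r_max * r_min" using r \<nu> by simp
          moreover have "y \<nu> * r_min \<le> y \<nu> * r_max" using r y \<nu> by (intro mult_left_mono) auto
          ultimately show ?thesis by (simp add: s_def t_def algebra_simps)
        qed
        have stb: "(s + \<beta>) * r_min \<le> (t + \<beta>) * r_max"
          unfolding distrib_right using st r \<beta> by (intro add_mono mult_left_mono) auto
        have "\<rho> * (w t * (t + \<beta>)) = (r_min / (r_max * t)) * (r_min / (r_max * (t + \<beta>)))"
          using t \<beta> by (simp add: \<rho>_def w_def power2_eq_square)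
        also have "\<dots> \<le> (1 / s) * (1 / (s + \<beta>))"
          using st stb t \<beta> r rmax0
          by (intro mult_mono) (simp_all add: pos_divide_le_eq pos_le_divide_eq mult.commute)
        also have "\<dots> = w s * (s + \<beta>)" using t \<beta> by (simp add: w_def power2_eq_square)
        finally show ?thesis .
      qed
      then have "2 * D * \<kappa> * (\<rho> * (w t * (t + \<beta>))) \<le> 2 * D * \<kappa> * (w s * (s + \<beta>))"
        using c \<kappa> by (intro mult_left_mono) auto
      ultimately have "w s * ((C * y \<nu> + cm) * \<beta> - 2 * D * \<kappa> * (s + \<beta>))
          \<le> w t * ((C * y \<nu> + cm) * \<beta>) - 2 * D * \<kappa> * (\<rho> * (w t * (t + \<beta>)))"
        by (simp add: algebra_simps)
      also have "\<dots> = w t * ((C * \<beta> - 2 * \<rho> * D * \<kappa>) * y \<nu> + (cm * \<beta> - 2 * \<rho> * D * \<kappa> * (r_min + \<beta>)))"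
        by (simp add: t_def algebra_simps)
      finally show ?thesis unfolding s_def t_def .
    qed
    have wr: "0 \<le> w (r_min + y \<nu>)" if "\<nu> \<in> I" for \<nu> using w0 r(1) y(1)[OF that] by auto
    show ?thesis
    proof (cases "C * \<beta> - 2 * \<rho> * D * \<kappa> \<le> 0")
      case True
      then have e: "cm * \<beta> - 2 * \<rho> * D * \<kappa> * (r_min + \<beta>) \<le> 0"
        using d11 by (simp add: \<rho>_def)
      show ?thesis
      proof (rule sum_nonpos)
        fix \<nu> assume \<nu>: "\<nu> \<in> I"
        have "w (r_min + y \<nu>) * ((C * \<beta> - 2 * \<rho> * D * \<kappa>) * y \<nu> + (cm * \<beta> - 2 * \<rho> * D * \<kappa> * (r_min + \<beta>))) \<le> 0"
          using True e wr [OF \<nu>] y(1)[OF \<nu>]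
          by (intro mult_nonneg_nonpos add_nonpos_nonpos mult_nonpos_nonneg) auto
        then show "w (r \<nu> + y \<nu>) * ((C * y \<nu> + cm) * \<beta> - 2 * D * \<kappa> * (r \<nu> + y \<nu> + \<beta>)) \<le> 0"
          using le [OF \<nu>] by linarith
      qed
    next
      case False
      define a where "a = C * \<beta> - 2 * \<rho> * D * \<kappa>"
      define e where "e = cm * \<beta> - 2 * \<rho> * D * \<kappa> * (r_min + \<beta>)"
      have a: "0 < a" using False by (simp add: a_def)
      have "x * a + real (card I) * e \<le> 0"
        using d12 False unfolding a_def e_def \<rho>_def [symmetric] by (simp add: algebra_simps)
      moreover have "a * (\<Sum>\<nu>\<in>I. y \<nu>) \<le> x * a" using a y(2) by (simp add: mult.commute)
      ultimately have G: "(\<Sum>\<nu>\<in>I. a * y \<nu> + e) \<le> 0"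
        by (simp add: sum.distrib sum_distrib_left)
      have "(\<Sum>\<nu>\<in>I. w (r_min + y \<nu>) * (a * y \<nu> + e)) \<le> 0"
      proof (rule sum_mult_nonpos_if_oppositely_ordered [OF fin _ wr G])
        fix i j assume ij: "i \<in> I" "j \<in> I"
        show "(w (r_min + y i) - w (r_min + y j)) * (a * y i + e - (a * y j + e)) \<le> 0"
          using w_mono [of "r_min + y i" "r_min + y j"] w_mono [of "r_min + y j" "r_min + y i"]
            ij y(1)[OF ij(1)] y(1)[OF ij(2)] r(1) a
          by (cases "y i \<le> y j") (auto simp: mult_le_0_iff right_diff_distrib [symmetric])
      qed
      then show ?thesis using sum_mono [OF le, of I "\<lambda>\<nu>. \<nu>"] unfolding a_def e_def by linarith
    qed
  next
    assume d21: ?d21 and d22: ?d22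
    define a where "a = C * \<beta> - 2 * D * \<kappa>"
    define e where "e = (cm - C * r_min) * \<beta> - 2 * D * \<kappa> * \<beta>"
    \<comment> \<open>Substitute \<open>y = s - r\<close>; then \<open>r\<close> occurs only in \<open>- C * \<beta> * r\<close>.\<close>
    have le: "(C * y \<nu> + cm) * \<beta> - 2 * D * \<kappa> * (r \<nu> + y \<nu> + \<beta>) \<le> a * (r \<nu> + y \<nu>) + e"
      if \<nu>: "\<nu> \<in> I" for \<nu>
    proof -
      have "C * \<beta> * r_min \<le> C * \<beta> * r \<nu>" using c \<beta> r \<nu> by (intro mult_left_mono) auto
      then show ?thesis by (simp add: a_def e_def algebra_simps)
    qed
    have "(\<Sum>\<nu>\<in>I. w (r \<nu> + y \<nu>) * (a * (r \<nu> + y \<nu>) + e)) \<le> 0"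
    proof (cases "a \<le> 0")
      case True
      then have "(cm - C * r_min) - 2 * D * \<kappa> \<le> 0" using d21 by (simp add: a_def)
      then have "((cm - C * r_min) - 2 * D * \<kappa>) * \<beta> \<le> 0" using \<beta> by (simp add: mult_le_0_iff)
      then have e: "e \<le> 0" by (simp add: e_def algebra_simps)
      show ?thesis
        using True e w0 s0 by (intro sum_nonpos mult_nonneg_nonpos add_nonpos_nonpos mult_nonpos_nonneg)
          (auto simp: less_imp_le)
    next
      case False
      then have a: "0 < a" by simp
      have "((\<Sum>\<nu>\<in>I. r \<nu>) + x) * a + real (card I) * e \<le> 0"
        using d22 a unfolding a_def e_def by (simp add: algebra_simps)
      moreover have "a * ((\<Sum>\<nu>\<in>I. r \<nu>) + (\<Sum>\<nu>\<in>I. y \<nu>)) \<le> ((\<Sum>\<nu>\<in>I. r \<nu>) + x) * a"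
        using a y(2) by (simp add: mult.commute)
      ultimately have G: "(\<Sum>\<nu>\<in>I. a * (r \<nu> + y \<nu>) + e) \<le> 0"
        by (simp add: sum.distrib sum_distrib_left algebra_simps)
      show ?thesis
      proof (rule sum_mult_nonpos_if_oppositely_ordered [OF fin _ _ G])
        fix i j assume ij: "i \<in> I" "j \<in> I"
        show "(w (r i + y i) - w (r j + y j)) * (a * (r i + y i) + e - (a * (r j + y j) + e)) \<le> 0"
          using w_mono [of "r i + y i" "r j + y j"] w_mono [of "r j + y j" "r i + y i"]
            s0 [OF ij(1)] s0 [OF ij(2)] a
          by (cases "r i + y i \<le> r j + y j") (auto simp: mult_le_0_iff right_diff_distrib [symmetric])
      qed (use w0 s0 in auto)
    qed
    moreover have "(\<Sum>\<nu>\<in>I. w (r \<nu> + y \<nu>) * ((C * y \<nu> + cm) * \<beta> - 2 * D * \<kappa> * (r \<nu> + y \<nu> + \<beta>)))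
       \<le> (\<Sum>\<nu>\<in>I. w (r \<nu> + y \<nu>) * (a * (r \<nu> + y \<nu>) + e))"
      using le w0 s0 by (intro sum_mono mult_left_mono) auto
    ultimately show ?thesis by linarith
  qed
  then have "\<beta> * (\<Sum>\<nu>\<in>I. w (r \<nu> + y \<nu>) * ((C * y \<nu> + cm) * \<beta> - 2 * D * \<kappa> * (r \<nu> + y \<nu> + \<beta>))) \<le> 0"
    using \<beta> by (simp add: mult_le_0_iff)
  then show ?thesis using sum_mono [OF term_le, of I "\<lambda>\<nu>. \<nu>"] by (simp add: sum_distrib_left)
qed

text \<open>Let \<open>\<kappa>\<close> be the leading quotient. It is small enough for both summands: for the constant one
  because \<open>\<kappa> \<le> b_min / b_max\<close>, for the fraction because \<open>\<kappa> \<le> lo * q_min / (hi * q_max)\<close>.\<close>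
lemma shrinkage_term_ge:
  fixes b b_min b_max lo hi q q_min q_max X K :: real
  assumes b: "0 < b_min" "b_min \<le> b" "b_min \<le> b_max"
    and ct: "0 < lo" "lo \<le> hi" and q: "0 < q_min" "q_min \<le> q" "q \<le> q_max"
    and X: "0 \<le> X" "X \<le> hi * K" and K: "0 \<le> K"
  shows "(b_min * lo * q_min) / (b_max * hi * q_max) * (b_max + 1 / (lo * K + q_min)) \<le> b + 1 / (X + q)"
proof -
  define \<rho> where "\<rho> = (lo * q_min) / (hi * q_max)"
  have pos: "0 < b_max" "0 < hi" "0 < q_max" "0 < q" using assms by linarith+
  have \<rho>: "0 \<le> \<rho>" "\<rho> \<le> 1"
    using assms pos unfolding \<rho>_def by (auto simp: divide_le_eq_1 intro!: mult_mono)
  have \<kappa>: "(b_min * lo * q_min) / (b_max * hi * q_max) = b_min / b_max * \<rho>" by (simp add: \<rho>_def)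
  have "b_min / b_max * \<rho> * b_max = b_min * \<rho>" using pos by simp
  also have "\<dots> \<le> b_min * 1" using \<rho> b by (intro mult_left_mono) auto
  also have "\<dots> \<le> b" using b by simp
  finally have 1: "b_min / b_max * \<rho> * b_max \<le> b" .
  have "b_min / b_max * \<rho> \<le> 1 * \<rho>" using \<rho> b pos by (intro mult_right_mono) auto
  then have "b_min / b_max * \<rho> * (1 / (lo * K + q_min)) \<le> \<rho> * (1 / (lo * K + q_min))"
    using ct K q by (intro mult_right_mono) auto
  also have "\<dots> \<le> 1 / (hi * K + q_max)"
  proof -
    have "(lo * hi * K) * q_min \<le> (lo * hi * K) * q_max" using ct q K pos by (intro mult_left_mono) auto
    moreover have "(q_min * q_max) * lo \<le> (q_min * q_max) * hi" using ct q pos by (intro mult_left_mono) auto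
    ultimately have "lo * q_min * (hi * K + q_max) \<le> hi * q_max * (lo * K + q_min)"
      by (simp add: algebra_simps)
    moreover have "0 < lo * K + q_min" "0 < hi * K + q_max"
      using ct q K pos by (auto intro!: add_nonneg_pos)
    ultimately show ?thesis using pos
      by (simp add: \<rho>_def pos_divide_le_eq pos_le_divide_eq mult_ac)
  qed
  also have "\<dots> \<le> 1 / (X + q)" using X q pos by (intro divide_left_mono add_mono) (auto intro!: mult_pos_pos add_nonneg_pos)
  finally show ?thesis using 1 unfolding \<kappa> distrib_left by linarith
qed

section \<open>The joint law of the counts\<close>

definition sample_space :: "nat \<Rightarrow> (nat \<Rightarrow> nat) \<Rightarrow> (nat \<Rightarrow> nat \<Rightarrow> nat) set" where
  "sample_space N m = (\<Pi>\<^sub>E \<nu>\<in>{1..N}. count_vectors (m \<nu>))"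

definition joint_mass ::
  "nat \<Rightarrow> (nat \<Rightarrow> nat) \<Rightarrow> (nat \<Rightarrow> real) \<Rightarrow> (nat \<Rightarrow> nat \<Rightarrow> real) \<Rightarrow> (nat \<Rightarrow> nat \<Rightarrow> nat) \<Rightarrow> real" where
  "joint_mass N m r p x = (\<Prod>\<nu>=1..N. neg_multinomial_mass (m \<nu>) (r \<nu>) (p \<nu>) (x \<nu>))"

definition joint_law ::
  "nat \<Rightarrow> (nat \<Rightarrow> nat) \<Rightarrow> (nat \<Rightarrow> real) \<Rightarrow> (nat \<Rightarrow> nat \<Rightarrow> real) \<Rightarrow> (nat \<Rightarrow> nat \<Rightarrow> nat) measure" where
  "joint_law N m r p = density (count_space (sample_space N m)) (\<lambda>x. ennreal (joint_mass N m r p x))"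

definition increment :: "(nat \<Rightarrow> nat \<Rightarrow> nat) \<Rightarrow> nat \<Rightarrow> nat \<Rightarrow> nat \<Rightarrow> nat \<Rightarrow> nat" where
  "increment x \<nu> i = x(\<nu> := (x \<nu>)(i := Suc (x \<nu> i)))"

definition count_total :: "nat \<Rightarrow> (nat \<Rightarrow> nat) \<Rightarrow> real" where
  "count_total k v = (\<Sum>j=1..k. real (v j))"

lemma count_total_nonneg: "0 \<le> count_total k v"
  by (simp add: count_total_def sum_nonneg)

lemma le_count_total: "i \<in> {1..k} \<Longrightarrow> real (v i) \<le> count_total k v"
  unfolding count_total_def by (rule member_le_sum) auto

lemma count_total_upd_Suc: "i \<in> {1..k} \<Longrightarrow> count_total k (v(i := Suc (v i))) = count_total k v + 1"
  unfolding count_total_def by (simp add: sum.remove [of "{Suc 0..k}" i])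

lemma countable_sample_space: "countable (sample_space N m)"
  unfolding sample_space_def count_vectors_def by (intro countable_PiE) auto

lemma neg_multinomial_mass_pos:
  assumes "q \<in> open_simplex k" "0 < s"
  shows "0 < neg_multinomial_mass k s q x"
  unfolding neg_multinomial_mass_def using assms
  by (intro mult_pos_pos divide_pos_pos prod_pos Gamma_real_pos add_pos_nonneg sum_nonneg)
    (auto simp: open_simplex_def PiE_def Pi_def)

lemma neg_multinomial_mass_upd_Suc:
  assumes "q \<in> open_simplex k" "0 < s" "i \<in> {1..k}"
  shows "neg_multinomial_mass k s q (x(i := Suc (x i))) * (real (x i) + 1)
       = q i * (s + count_total k x) * neg_multinomial_mass k s q x"
proof -
  let ?x = "x(i := Suc (x i))"
  have t: "(\<Sum>j=1..k. real (?x j)) = count_total k x + 1"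
    using count_total_upd_Suc [OF assms(3)] by (simp only: count_total_def)
  have f: "(\<Prod>j=1..k. fact (?x j)) = (real (x i) + 1) * (\<Prod>j=1..k. fact (x j) :: real)"
    using assms(3) by (simp add: prod.remove [of "{Suc 0..k}" i] distrib_right)
  have q: "(\<Prod>j=1..k. q j ^ ?x j) = q i * (\<Prod>j=1..k. q j ^ x j)"
    using assms(3) by (simp add: prod.remove [of "{Suc 0..k}" i] distrib_right)
  have pos: "0 < s + count_total k x" using assms count_total_nonneg [of k x] by linarith
  have g: "Gamma (s + (count_total k x + 1)) = (s + count_total k x) * Gamma (s + count_total k x)"
    using Gamma_plus1 [of "s + count_total k x"] pos by (auto simp: add.assoc nonpos_Ints_def)
  have nz: "real (x i) + 1 \<noteq> 0" by linarith
  show ?thesis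
    unfolding neg_multinomial_mass_def t f q
    unfolding count_total_def [symmetric] g using nz by simp
qed

lemma joint_mass_pos:
  assumes "p \<in> param_space N m" "\<And>\<nu>. \<nu> \<in> {1..N} \<Longrightarrow> 0 < r \<nu>"
  shows "0 < joint_mass N m r p x"
  unfolding joint_mass_def using assms
  by (intro prod_pos neg_multinomial_mass_pos) (auto simp: param_space_def PiE_def Pi_def)

text \<open>The ratio of the mass function at neighbouring points carries all distributional information
  that the comparison of risks needs.\<close>
lemma joint_mass_increment:
  assumes p: "p \<in> param_space N m" and r: "\<And>\<nu>. \<nu> \<in> {1..N} \<Longrightarrow> 0 < r \<nu>"
    and \<nu>: "\<nu> \<in> {1..N}" and i: "i \<in> {1..m \<nu>}"
  shows "joint_mass N m r p (increment x \<nu> i) * (real (x \<nu> i) + 1)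
       = p \<nu> i * (r \<nu> + count_total (m \<nu>) (x \<nu>)) * joint_mass N m r p x"
proof -
  have q: "p \<nu> \<in> open_simplex (m \<nu>)" using p \<nu> by (auto simp: param_space_def)
  let ?R = "\<Prod>\<mu>\<in>{1..N} - {\<nu>}. neg_multinomial_mass (m \<mu>) (r \<mu>) (p \<mu>) (x \<mu>)"
  have 1: "joint_mass N m r p x = neg_multinomial_mass (m \<nu>) (r \<nu>) (p \<nu>) (x \<nu>) * ?R"
    unfolding joint_mass_def using \<nu> by (simp add: prod.remove)
  have 2: "joint_mass N m r p (increment x \<nu> i)
      = neg_multinomial_mass (m \<nu>) (r \<nu>) (p \<nu>) ((x \<nu>)(i := Suc (x \<nu> i))) * ?R"
    unfolding joint_mass_def using \<nu> by (simp add: prod.remove increment_def)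
  have "joint_mass N m r p (increment x \<nu> i) * (real (x \<nu> i) + 1)
      = neg_multinomial_mass (m \<nu>) (r \<nu>) (p \<nu>) ((x \<nu>)(i := Suc (x \<nu> i))) * (real (x \<nu> i) + 1) * ?R"
    unfolding 2 by (simp only: mult_ac)
  also have "\<dots> = p \<nu> i * (r \<nu> + count_total (m \<nu>) (x \<nu>)) * neg_multinomial_mass (m \<nu>) (r \<nu>) (p \<nu>) (x \<nu>) * ?R"
    by (simp only: neg_multinomial_mass_upd_Suc [OF q r [OF \<nu>] i])
  finally show ?thesis unfolding 1 by (simp only: mult.assoc)
qed

lemma increment_in_sample_space:
  "x \<in> sample_space N m \<Longrightarrow> \<nu> \<in> {1..N} \<Longrightarrow> i \<in> {1..m \<nu>} \<Longrightarrow> increment x \<nu> i \<in> sample_space N m"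
  by (auto simp: sample_space_def count_vectors_def increment_def PiE_def Pi_def extensional_def)

lemma bij_betw_increment:
  assumes "\<nu> \<in> {1..N}" "i \<in> {1..m \<nu>}"
  shows "bij_betw (\<lambda>x. increment x \<nu> i) (sample_space N m) {x \<in> sample_space N m. 0 < x \<nu> i}"
proof (rule bij_betw_byWitness [where f' = "\<lambda>x. x(\<nu> := (x \<nu>)(i := x \<nu> i - 1))"])
  show "(\<lambda>x. x(\<nu> := (x \<nu>)(i := x \<nu> i - 1))) ` {x \<in> sample_space N m. 0 < x \<nu> i} \<subseteq> sample_space N m"
    using assms by (auto simp: sample_space_def count_vectors_def PiE_def Pi_def extensional_def)
  show "(\<lambda>x. increment x \<nu> i) ` sample_space N m \<subseteq> {x \<in> sample_space N m. 0 < x \<nu> i}"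
    using assms increment_in_sample_space by (auto simp: increment_def)
qed (auto simp: increment_def)

text \<open>The sample space is countable, so independence determines the joint law through the masses of
  single points.\<close>
lemma distr_observations:
  assumes model: "neg_multinomial_model N m r M X" and p: "p \<in> param_space N m"
    and r: "\<And>\<nu>. \<nu> \<in> {1..N} \<Longrightarrow> 0 < r \<nu>" and N: "N \<ge> 1"
  shows "(\<lambda>\<omega>. restrict (\<lambda>\<nu>. X \<nu> \<omega>) {1..N}) \<in> measurable (M p) (count_space (sample_space N m))" (is ?meas)
    and "distr (M p) (count_space (sample_space N m)) (\<lambda>\<omega>. restrict (\<lambda>\<nu>. X \<nu> \<omega>) {1..N})
       = joint_law N m r p" (is ?law)
proof -
  let ?Y = "\<lambda>\<omega>. restrict (\<lambda>\<nu>. X \<nu> \<omega>) {1..N}"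
  let ?S = "sample_space N m"
  interpret prob_space "M p" using model p by (simp add: neg_multinomial_model_def)
  have ind: "indep_vars (\<lambda>\<nu>. count_space (count_vectors (m \<nu>))) X {1..N}"
    using model p by (simp add: neg_multinomial_model_def)
  have dis: "distributed (M p) (count_space (count_vectors (m \<nu>))) (X \<nu>)
            (\<lambda>x. ennreal (neg_multinomial_mass (m \<nu>) (r \<nu>) (p \<nu>) x))" if "\<nu> \<in> {1..N}" for \<nu>
    using model p that by (simp add: neg_multinomial_model_def)
  have meas: "X \<nu> \<in> measurable (M p) (count_space (count_vectors (m \<nu>)))" if "\<nu> \<in> {1..N}" for \<nu>
    using distributed_measurable [OF dis [OF that]] by simp
  have sp: "X \<nu> \<omega> \<in> count_vectors (m \<nu>)" if "\<nu> \<in> {1..N}" "\<omega> \<in> space (M p)" for \<nu> \<omega>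
    using measurable_space [OF meas [OF that(1)] that(2)] by simp
  have pre: "?Y -` {a} \<inter> space (M p) = (\<Inter>\<nu>\<in>{1..N}. X \<nu> -` {a \<nu>} \<inter> space (M p))"
    if a: "a \<in> ?S" for a
  proof -
    have "?Y \<omega> = a \<longleftrightarrow> (\<forall>\<nu>\<in>{1..N}. X \<nu> \<omega> = a \<nu>)" for \<omega>
      using a by (auto simp: sample_space_def PiE_def extensional_def restrict_def fun_eq_iff)
    then show ?thesis using N by auto
  qed
  have a_in: "a \<nu> \<in> count_vectors (m \<nu>)" if "a \<in> ?S" "\<nu> \<in> {1..N}" for a \<nu>
    using that by (auto simp: sample_space_def)
  have ev: "X \<nu> -` {a \<nu>} \<inter> space (M p) \<in> events" if "a \<in> ?S" "\<nu> \<in> {1..N}" for a \<nu>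
    using measurable_sets [OF meas [OF that(2)], of "{a \<nu>}"] a_in [OF that] by simp
  show 1: ?meas
    unfolding measurable_count_space_eq_countable [OF countable_sample_space]
  proof (intro conjI ballI)
    show "?Y \<in> space (M p) \<rightarrow> ?S" using sp by (auto simp: sample_space_def)
    fix a assume a: "a \<in> ?S"
    show "?Y -` {a} \<inter> space (M p) \<in> events"
      unfolding pre [OF a] using N ev [OF a] by (intro sets.finite_INT) auto
  qed
  show ?law
  proof (rule measure_eqI_countable [OF _ _ countable_sample_space])
    show "sets (distr (M p) (count_space ?S) ?Y) = Pow ?S" by simp
    show "sets (joint_law N m r p) = Pow ?S" by (simp add: joint_law_def)
    fix a assume a: "a \<in> ?S"
    have one: "prob (X \<nu> -` {a \<nu>} \<inter> space (M p)) = neg_multinomial_mass (m \<nu>) (r \<nu>) (p \<nu>) (a \<nu>)"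
      if \<nu>: "\<nu> \<in> {1..N}" for \<nu>
    proof -
      have "emeasure (M p) (X \<nu> -` {a \<nu>} \<inter> space (M p))
         = ennreal (neg_multinomial_mass (m \<nu>) (r \<nu>) (p \<nu>) (a \<nu>))"
        using distributed_emeasure [OF dis [OF \<nu>], of "{a \<nu>}"] a_in [OF a \<nu>]
        by (simp add: nn_integral_indicator_singleton)
      moreover have "0 \<le> neg_multinomial_mass (m \<nu>) (r \<nu>) (p \<nu>) (a \<nu>)"
      proof -
        have "p \<nu> \<in> open_simplex (m \<nu>)" using p \<nu> by (auto simp: param_space_def)
        then show ?thesis using neg_multinomial_mass_pos r [OF \<nu>] less_imp_le by blast
      qed
      ultimately show ?thesis by (simp add: measure_def)
    qed
    have "emeasure (distr (M p) (count_space ?S) ?Y) {a} = emeasure (M p) (?Y -` {a} \<inter> space (M p))"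
      using 1 a by (simp add: emeasure_distr)
    also have "\<dots> = ennreal (prob (\<Inter>\<nu>\<in>{1..N}. X \<nu> -` {a \<nu>} \<inter> space (M p)))"
      unfolding pre [OF a] by (rule emeasure_eq_measure)
    also have "prob (\<Inter>\<nu>\<in>{1..N}. X \<nu> -` {a \<nu>} \<inter> space (M p)) = (\<Prod>\<nu>=1..N. prob (X \<nu> -` {a \<nu>} \<inter> space (M p)))"
      using N a_in [OF a] by (intro indep_varsD_finite [OF ind]) auto
    also have "\<dots> = joint_mass N m r p a" unfolding joint_mass_def using one by (intro prod.cong) auto
    also have "ennreal (joint_mass N m r p a) = emeasure (joint_law N m r p) {a}"
      unfolding joint_law_def using a by (simp add: emeasure_density nn_integral_indicator_singleton)
    finally show "emeasure (distr (M p) (count_space ?S) ?Y) {a} = emeasure (joint_law N m r p) {a}" .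
  qed
qed

lemma prob_space_joint_law:
  assumes "neg_multinomial_model N m r M X" "p \<in> param_space N m"
    "\<And>\<nu>. \<nu> \<in> {1..N} \<Longrightarrow> 0 < r \<nu>" "N \<ge> 1"
  shows "prob_space (joint_law N m r p)"
proof -
  have "prob_space (M p)" using assms(1,2) by (simp add: neg_multinomial_model_def)
  then show ?thesis
    using prob_space.prob_space_distr distr_observations [of N m r M X p] assms by metis
qed

text \<open>The populations outside \<open>{1..N}\<close> are unconstrained by the model, whence the assumption that
  the loss ignores them.\<close>
lemma risk_eq_nn_integral_joint_law:
  assumes "neg_multinomial_model N m r M X" "p \<in> param_space N m"
    "\<And>\<nu>. \<nu> \<in> {1..N} \<Longrightarrow> 0 < r \<nu>" "N \<ge> 1"
    and dep: "\<And>x. L (\<delta> (restrict x {1..N})) p = L (\<delta> x) p"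
  shows "risk M X L \<delta> p = (\<integral>\<^sup>+ x. ennreal (L (\<delta> x) p) \<partial>joint_law N m r p)"
proof -
  let ?Y = "\<lambda>\<omega>. restrict (\<lambda>\<nu>. X \<nu> \<omega>) {1..N}"
  have Y: "?Y \<in> measurable (M p) (count_space (sample_space N m))"
    by (rule distr_observations(1) [where r = r]) (use assms in auto)
  have law: "distr (M p) (count_space (sample_space N m)) ?Y = joint_law N m r p"
    by (rule distr_observations(2)) (use assms in auto)
  have "(\<integral>\<^sup>+ x. ennreal (L (\<delta> x) p) \<partial>joint_law N m r p)
      = (\<integral>\<^sup>+ \<omega>. ennreal (L (\<delta> (restrict (\<lambda>\<nu>. X \<nu> \<omega>) {1..N})) p) \<partial>M p)"
    by (subst law [symmetric], rule nn_integral_distr [OF Y]) simp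
  then show ?thesis by (simp only: risk_def dep)
qed

section \<open>Unbiased estimation of the risk\<close>

text \<open>The analogue of Stein's identity: since \<open>F\<close> vanishes where the count is zero, the sum runs
  over the image of the increment, and can be reindexed over the whole sample space.\<close>
lemma nn_integral_joint_law_increment:
  assumes p: "p \<in> param_space N m" and r: "\<And>\<nu>. \<nu> \<in> {1..N} \<Longrightarrow> 0 < r \<nu>"
    and \<nu>: "\<nu> \<in> {1..N}" and i: "i \<in> {1..m \<nu>}"
    and F: "\<And>x. 0 \<le> F x" "\<And>x. x \<nu> i = 0 \<Longrightarrow> F x = 0"
  shows "(\<integral>\<^sup>+ x. ennreal (F x / p \<nu> i) \<partial>joint_law N m r p)
       = (\<integral>\<^sup>+ x. ennreal (F (increment x \<nu> i) * (r \<nu> + count_total (m \<nu>) (x \<nu>)) / (real (x \<nu> i) + 1))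
            \<partial>joint_law N m r p)"
proof -
  let ?S = "sample_space N m"
  let ?J = "joint_mass N m r p"
  have J: "0 < ?J x" for x using joint_mass_pos [of p N m r x] p r by blast
  have pi: "0 < p \<nu> i" using p \<nu> i by (auto simp: param_space_def open_simplex_def PiE_def Pi_def)
  have "(\<integral>\<^sup>+ x. ennreal (F x / p \<nu> i) \<partial>joint_law N m r p)
      = (\<integral>\<^sup>+ x. ennreal (?J x) * ennreal (F x / p \<nu> i) \<partial>count_space ?S)"
    unfolding joint_law_def by (subst nn_integral_density) auto
  also have "\<dots> = (\<integral>\<^sup>+ x. ennreal (?J x) * ennreal (F x / p \<nu> i) \<partial>count_space {x \<in> ?S. 0 < x \<nu> i})"
    by (rule nn_integral_count_space_eq) (auto simp: F)
  also have "\<dots> = (\<integral>\<^sup>+ x. ennreal (?J (increment x \<nu> i)) * ennreal (F (increment x \<nu> i) / p \<nu> i) \<partial>count_space ?S)"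
    by (rule nn_integral_bij_count_space [symmetric, OF bij_betw_increment]) (use \<nu> i in auto)
  also have "\<dots> = (\<integral>\<^sup>+ x. ennreal (?J x) *
        ennreal (F (increment x \<nu> i) * (r \<nu> + count_total (m \<nu>) (x \<nu>)) / (real (x \<nu> i) + 1)) \<partial>count_space ?S)"
  proof (rule nn_integral_cong)
    fix x
    have "?J (increment x \<nu> i) = p \<nu> i * (r \<nu> + count_total (m \<nu>) (x \<nu>)) * ?J x / (real (x \<nu> i) + 1)"
      using joint_mass_increment [of p N m r \<nu> i x, OF p r \<nu> i] by (simp add: eq_divide_eq)
    then have "?J (increment x \<nu> i) * (F (increment x \<nu> i) / p \<nu> i)
        = ?J x * (F (increment x \<nu> i) * (r \<nu> + count_total (m \<nu>) (x \<nu>)) / (real (x \<nu> i) + 1))"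
      using pi by simp
    then show "ennreal (?J (increment x \<nu> i)) * ennreal (F (increment x \<nu> i) / p \<nu> i)
       = ennreal (?J x) * ennreal (F (increment x \<nu> i) * (r \<nu> + count_total (m \<nu>) (x \<nu>)) / (real (x \<nu> i) + 1))"
      using J by (simp add: ennreal_mult' [symmetric] less_imp_le)
  qed
  also have "\<dots> = (\<integral>\<^sup>+ x. ennreal (F (increment x \<nu> i) * (r \<nu> + count_total (m \<nu>) (x \<nu>)) / (real (x \<nu> i) + 1))
            \<partial>joint_law N m r p)"
    unfolding joint_law_def by (subst nn_integral_density) auto
  finally show ?thesis .
qed

lemma joint_law_measurable [simp]: "f \<in> borel_measurable (joint_law N m r p)"
  by (simp add: joint_law_def)

lemma integral_joint_law_increment:
  assumes p: "p \<in> param_space N m" and r: "\<And>\<nu>. \<nu> \<in> {1..N} \<Longrightarrow> 0 < r \<nu>"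
    and \<nu>: "\<nu> \<in> {1..N}" and i: "i \<in> {1..m \<nu>}"
    and F: "\<And>x. 0 \<le> F x" "\<And>x. x \<nu> i = 0 \<Longrightarrow> F x = 0"
  shows "(\<integral>x. F x / p \<nu> i \<partial>joint_law N m r p)
       = (\<integral>x. F (increment x \<nu> i) * (r \<nu> + count_total (m \<nu>) (x \<nu>)) / (real (x \<nu> i) + 1) \<partial>joint_law N m r p)"
proof -
  have pi: "0 < p \<nu> i" using p \<nu> i by (auto simp: param_space_def open_simplex_def PiE_def Pi_def)
  have t: "0 \<le> r \<nu> + count_total (m \<nu>) v" for v using r [OF \<nu>] count_total_nonneg [of "m \<nu>" v] by linarith
  have "(\<integral>x. F x / p \<nu> i \<partial>joint_law N m r p) = enn2real (\<integral>\<^sup>+ x. ennreal (F x / p \<nu> i) \<partial>joint_law N m r p)"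
    using F(1) pi by (intro integral_eq_nn_integral) auto
  also have "\<dots> = enn2real (\<integral>\<^sup>+ x. ennreal (F (increment x \<nu> i) * (r \<nu> + count_total (m \<nu>) (x \<nu>)) / (real (x \<nu> i) + 1))
            \<partial>joint_law N m r p)"
    by (simp only: nn_integral_joint_law_increment [of p N m r \<nu> i F, OF p r \<nu> i F])
  also have "\<dots> = (\<integral>x. F (increment x \<nu> i) * (r \<nu> + count_total (m \<nu>) (x \<nu>)) / (real (x \<nu> i) + 1) \<partial>joint_law N m r p)"
    using F(1) t by (intro integral_eq_nn_integral [symmetric]) auto
  finally show ?thesis .
qed

text \<open>The unbiased estimate of the risk of \<open>X\<nu>i / (r\<nu> + X.\<nu> - 1 + h\<nu>(X))\<close>, without the
  summand \<open>\<Sum>c p\<close> that is the same for all estimators. Its first part is the image of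
  the square of the estimator, divided by the parameter, under Stein's identity.\<close>
definition unbiased_risk ::
  "(nat \<Rightarrow> nat) \<Rightarrow> nat \<Rightarrow> (nat \<Rightarrow> real) \<Rightarrow> (nat \<Rightarrow> nat \<Rightarrow> real)
    \<Rightarrow> (nat \<Rightarrow> (nat \<Rightarrow> nat \<Rightarrow> nat) \<Rightarrow> real) \<Rightarrow> (nat \<Rightarrow> nat \<Rightarrow> nat) \<Rightarrow> real" where
  "unbiased_risk m n r c h x = (\<Sum>\<nu>=1..n. \<Sum>i=1..m \<nu>. c \<nu> i *
     ((real (x \<nu> i) + 1) * ((r \<nu> + count_total (m \<nu>) (x \<nu>)) / (r \<nu> + count_total (m \<nu>) (x \<nu>) + h \<nu> (increment x \<nu> i))\<^sup>2)
       - 2 * (real (x \<nu> i) / (r \<nu> + count_total (m \<nu>) (x \<nu>) - 1 + h \<nu> x))))"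

text \<open>Expanding the square gives \<open>\<delta>\<^sup>2 / p - 2 * \<delta> + p\<close>, and only \<open>\<delta>\<^sup>2 / p\<close> requires Stein's
  identity. As \<open>r > 1\<close> on the populations that enter the loss, \<open>\<delta>\<close> and all other integrands are
  bounded, so all expectations are finite and may be split.\<close>
lemma expected_loss_eq_unbiased_risk:
  fixes h :: "nat \<Rightarrow> (nat \<Rightarrow> nat \<Rightarrow> nat) \<Rightarrow> real"
  assumes ps: "prob_space (joint_law N m r p)" and p: "p \<in> param_space N m"
    and r: "\<And>\<nu>. \<nu> \<in> {1..N} \<Longrightarrow> 0 < r \<nu>" and n: "n \<le> N"
    and r1: "\<And>\<nu>. \<nu> \<in> {1..n} \<Longrightarrow> 1 < r \<nu>"
    and h: "\<And>\<nu> x. \<nu> \<in> {1..n} \<Longrightarrow> 0 \<le> h \<nu> x"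
    and c: "\<And>\<nu> i. \<nu> \<in> {1..n} \<Longrightarrow> i \<in> {1..m \<nu>} \<Longrightarrow> 0 \<le> c \<nu> i"
    and \<delta>: "\<And>x \<nu> i. \<nu> \<in> {1..n} \<Longrightarrow> i \<in> {1..m \<nu>} \<Longrightarrow>
               \<delta> x \<nu> i = real (x \<nu> i) / (r \<nu> + count_total (m \<nu>) (x \<nu>) - 1 + h \<nu> x)"
  shows "integrable (joint_law N m r p) (unbiased_risk m n r c h)"
    and "(\<integral>\<^sup>+ x. ennreal (std_sq_loss m n c (\<delta> x) p) \<partial>joint_law N m r p)
       = ennreal ((\<integral>x. unbiased_risk m n r c h x \<partial>joint_law N m r p) + (\<Sum>\<nu>=1..n. \<Sum>i=1..m \<nu>. c \<nu> i * p \<nu> i))"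
    and "0 \<le> (\<integral>x. unbiased_risk m n r c h x \<partial>joint_law N m r p) + (\<Sum>\<nu>=1..n. \<Sum>i=1..m \<nu>. c \<nu> i * p \<nu> i)"
proof -
  let ?Q = "joint_law N m r p"
  interpret prob_space ?Q by (rule ps)
  define s where "s \<nu> x = r \<nu> + count_total (m \<nu>) (x \<nu>)" for \<nu> and x :: "nat \<Rightarrow> nat \<Rightarrow> nat"
  define d where "d \<nu> i x = real (x \<nu> i) / (s \<nu> x - 1 + h \<nu> x)" for \<nu> i x
  define v where "v \<nu> i x = (real (x \<nu> i) + 1) * (s \<nu> x / (s \<nu> x + h \<nu> (increment x \<nu> i))\<^sup>2)" for \<nu> i x
  have s1: "1 + real (x \<nu> i) < s \<nu> x" if "\<nu> \<in> {1..n}" "i \<in> {1..m \<nu>}" for \<nu> i x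
    using r1 [OF that(1)] le_count_total [OF that(2), of "x \<nu>"] by (simp add: s_def)
  have s1': "1 < s \<nu> x" if "\<nu> \<in> {1..n}" for \<nu> x
    using r1 [OF that(1)] count_total_nonneg [of "m \<nu>" "x \<nu>"] by (simp add: s_def)
  have d01: "0 \<le> d \<nu> i x" "d \<nu> i x \<le> 1" if "\<nu> \<in> {1..n}" "i \<in> {1..m \<nu>}" for \<nu> i x
    using s1 [OF that, of x] s1' [OF that(1), of x] h [OF that(1), of x] by (auto simp: d_def)
  have v01: "0 \<le> v \<nu> i x" "v \<nu> i x \<le> 1" if that: "\<nu> \<in> {1..n}" "i \<in> {1..m \<nu>}" for \<nu> i x
  proof -
    have s: "1 + real (x \<nu> i) < s \<nu> x" "0 < s \<nu> x" "0 \<le> h \<nu> (increment x \<nu> i)"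
      using s1 [OF that, of x] s1' [OF that(1), of x] h [OF that(1)] by auto
    show "0 \<le> v \<nu> i x" using s by (auto simp: v_def)
    have "v \<nu> i x \<le> s \<nu> x * (s \<nu> x / (s \<nu> x + h \<nu> (increment x \<nu> i))\<^sup>2)"
      unfolding v_def using s by (intro mult_right_mono) auto
    also have "\<dots> = (s \<nu> x / (s \<nu> x + h \<nu> (increment x \<nu> i)))\<^sup>2" by (simp add: power2_eq_square)
    also have "\<dots> \<le> 1" using s by (intro power_le_one) auto
    finally show "v \<nu> i x \<le> 1" .
  qed
  have pi: "0 < p \<nu> i" if "\<nu> \<in> {1..n}" "i \<in> {1..m \<nu>}" for \<nu> i
    using p that n by (auto simp: param_space_def open_simplex_def PiE_def Pi_def)
  have int_d: "integrable ?Q (d \<nu> i)" and int_d2: "integrable ?Q (\<lambda>x. (d \<nu> i x)\<^sup>2 / p \<nu> i)"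
    and int_v: "integrable ?Q (v \<nu> i)" if that: "\<nu> \<in> {1..n}" "i \<in> {1..m \<nu>}" for \<nu> i
  proof -
    show "integrable ?Q (d \<nu> i)"
      by (rule integrable_const_bound [where B = 1]) (use d01 [OF that] in auto)
    show "integrable ?Q (v \<nu> i)"
      by (rule integrable_const_bound [where B = 1]) (use v01 [OF that] in auto)
    show "integrable ?Q (\<lambda>x. (d \<nu> i x)\<^sup>2 / p \<nu> i)"
    proof (rule integrable_const_bound [where B = "1 / p \<nu> i"])
      have "(d \<nu> i x)\<^sup>2 / p \<nu> i \<le> 1 / p \<nu> i" for x
        using d01 [OF that, of x] pi [OF that] by (intro divide_right_mono power_le_one) auto
      then show "AE x in ?Q. norm ((d \<nu> i x)\<^sup>2 / p \<nu> i) \<le> 1 / p \<nu> i"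
        using pi [OF that] by auto
    qed simp
  qed
  have U: "unbiased_risk m n r c h x = (\<Sum>\<nu>=1..n. \<Sum>i=1..m \<nu>. c \<nu> i * (v \<nu> i x - 2 * d \<nu> i x))" for x
    by (simp add: unbiased_risk_def v_def d_def s_def)
  have loss: "std_sq_loss m n c (\<delta> x) p
      = (\<Sum>\<nu>=1..n. \<Sum>i=1..m \<nu>. c \<nu> i * ((d \<nu> i x)\<^sup>2 / p \<nu> i - 2 * d \<nu> i x + p \<nu> i))" for x
    unfolding std_sq_loss_def
  proof (intro sum.cong refl)
    fix \<nu> i assume *: "\<nu> \<in> {1..n}" "i \<in> {1..m \<nu>}"
    have "\<delta> x \<nu> i = d \<nu> i x" using \<delta> [OF *] by (simp add: d_def s_def)
    then show "c \<nu> i * ((\<delta> x \<nu> i - p \<nu> i)\<^sup>2 / p \<nu> i) = c \<nu> i * ((d \<nu> i x)\<^sup>2 / p \<nu> i - 2 * d \<nu> i x + p \<nu> i)"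
      using pi [OF *] by (simp add: power2_eq_square field_simps)
  qed
  show int: "integrable ?Q (unbiased_risk m n r c h)"
    unfolding U using int_v int_d
    by (intro Bochner_Integration.integrable_sum integrable_mult_right Bochner_Integration.integrable_diff) auto
  have shift: "(\<integral>x. (d \<nu> i x)\<^sup>2 / p \<nu> i \<partial>?Q) = (\<integral>x. v \<nu> i x \<partial>?Q)" if that: "\<nu> \<in> {1..n}" "i \<in> {1..m \<nu>}" for \<nu> i
  proof -
    have "(\<integral>x. (d \<nu> i x)\<^sup>2 / p \<nu> i \<partial>?Q)
        = (\<integral>x. (d \<nu> i (increment x \<nu> i))\<^sup>2 * (r \<nu> + count_total (m \<nu>) (x \<nu>)) / (real (x \<nu> i) + 1) \<partial>?Q)"
      using that n by (intro integral_joint_law_increment [OF p r]) (auto simp: d_def)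
    also have "(\<lambda>x. (d \<nu> i (increment x \<nu> i))\<^sup>2 * (r \<nu> + count_total (m \<nu>) (x \<nu>)) / (real (x \<nu> i) + 1)) = v \<nu> i"
    proof
      fix x
      have t: "s \<nu> (increment x \<nu> i) = s \<nu> x + 1"
        using count_total_upd_Suc [OF that(2), of "x \<nu>"] by (simp add: s_def increment_def)
      have e: "real (increment x \<nu> i \<nu> i) = real (x \<nu> i) + 1" by (simp add: increment_def)
      have nz: "real (x \<nu> i) + 1 \<noteq> 0" by linarith
      have "d \<nu> i (increment x \<nu> i) = (real (x \<nu> i) + 1) / (s \<nu> x + h \<nu> (increment x \<nu> i))"
        unfolding d_def t e by simp
      then show "(d \<nu> i (increment x \<nu> i))\<^sup>2 * (r \<nu> + count_total (m \<nu>) (x \<nu>)) / (real (x \<nu> i) + 1) = v \<nu> i x"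
        unfolding v_def s_def [symmetric] using nz by (simp add: power2_eq_square)
    qed
    finally show ?thesis .
  qed
  have shift': "(\<integral>x. (d \<nu> i x)\<^sup>2 \<partial>?Q) / p \<nu> i = (\<integral>x. v \<nu> i x \<partial>?Q)"
    if "\<nu> \<in> {1..n}" "i \<in> {1..m \<nu>}" for \<nu> i using shift [OF that] by simp
  have int_loss: "integrable ?Q (\<lambda>x. std_sq_loss m n c (\<delta> x) p)"
    unfolding loss using int_d int_d2
    by (intro Bochner_Integration.integrable_sum integrable_mult_right Bochner_Integration.integrable_diff
        Bochner_Integration.integrable_add) auto
  have E_loss: "(\<integral>x. std_sq_loss m n c (\<delta> x) p \<partial>?Q)
      = (\<Sum>\<nu>=1..n. \<Sum>i=1..m \<nu>. c \<nu> i * ((\<integral>x. v \<nu> i x \<partial>?Q) - 2 * (\<integral>x. d \<nu> i x \<partial>?Q) + p \<nu> i))"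
    unfolding loss using int_d int_d2
    by (subst Bochner_Integration.integral_sum, force, intro sum.cong refl,
        subst Bochner_Integration.integral_sum, force, intro sum.cong refl) (simp add: shift' prob_space)
  have E_U: "(\<integral>x. unbiased_risk m n r c h x \<partial>?Q)
      = (\<Sum>\<nu>=1..n. \<Sum>i=1..m \<nu>. c \<nu> i * ((\<integral>x. v \<nu> i x \<partial>?Q) - 2 * (\<integral>x. d \<nu> i x \<partial>?Q)))"
    unfolding U using int_d int_v
    by (subst Bochner_Integration.integral_sum, force, intro sum.cong refl,
        subst Bochner_Integration.integral_sum, force, intro sum.cong refl) simp
  have eq: "(\<integral>x. std_sq_loss m n c (\<delta> x) p \<partial>?Q)
      = (\<integral>x. unbiased_risk m n r c h x \<partial>?Q) + (\<Sum>\<nu>=1..n. \<Sum>i=1..m \<nu>. c \<nu> i * p \<nu> i)"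
    unfolding E_loss E_U by (simp add: distrib_left sum.distrib)
  have nonneg: "0 \<le> std_sq_loss m n c (\<delta> x) p" for x
    unfolding std_sq_loss_def using c pi by (intro sum_nonneg mult_nonneg_nonneg divide_nonneg_nonneg) (auto intro: less_imp_le)
  show "(\<integral>\<^sup>+ x. ennreal (std_sq_loss m n c (\<delta> x) p) \<partial>?Q)
       = ennreal ((\<integral>x. unbiased_risk m n r c h x \<partial>?Q) + (\<Sum>\<nu>=1..n. \<Sum>i=1..m \<nu>. c \<nu> i * p \<nu> i))"
    unfolding eq [symmetric] using int_loss nonneg by (intro nn_integral_eq_integral) auto
  show "0 \<le> (\<integral>x. unbiased_risk m n r c h x \<partial>?Q) + (\<Sum>\<nu>=1..n. \<Sum>i=1..m \<nu>. c \<nu> i * p \<nu> i)"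
    unfolding eq [symmetric] using nonneg by (intro integral_nonneg_AE) auto
qed

lemma unbiased_risk_diff_umvu:
  "unbiased_risk m n r c h x - unbiased_risk m n r c (\<lambda>_ _. 0) x = (\<Sum>\<nu>=1..n. \<Sum>i=1..m \<nu>. c \<nu> i *
     ((real (x \<nu> i) + 1) * ((r \<nu> + count_total (m \<nu>) (x \<nu>)) / (r \<nu> + count_total (m \<nu>) (x \<nu>) + h \<nu> (increment x \<nu> i))\<^sup>2
          - 1 / (r \<nu> + count_total (m \<nu>) (x \<nu>)))
       + 2 * real (x \<nu> i) * (1 / (r \<nu> + count_total (m \<nu>) (x \<nu>) - 1) - 1 / (r \<nu> + count_total (m \<nu>) (x \<nu>) - 1 + h \<nu> x))))"
proof -
  have sq: "s / (s + 0)\<^sup>2 = 1 / s" for s :: real by (simp add: power2_eq_square)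
  show ?thesis
    unfolding unbiased_risk_def sum_subtractf [symmetric] sq by (intro sum.cong refl) (simp add: algebra_simps)
qed

text \<open>At zero counts both estimators vanish, and only the strictly decreasing first part remains.\<close>
lemma unbiased_risk_less_umvu_at_zero:
  assumes x: "\<And>\<nu> i. \<nu> \<in> {1..n} \<Longrightarrow> i \<in> {1..m \<nu>} \<Longrightarrow> x \<nu> i = 0"
    and r: "\<And>\<nu>. \<nu> \<in> {1..n} \<Longrightarrow> 0 < r \<nu>"
    and h: "\<And>\<nu> x. \<nu> \<in> {1..n} \<Longrightarrow> 0 < h \<nu> x"
    and c: "\<And>\<nu> i. \<nu> \<in> {1..n} \<Longrightarrow> i \<in> {1..m \<nu>} \<Longrightarrow> 0 \<le> c \<nu> i"
    and pos: "\<mu> \<in> {1..n}" "k \<in> {1..m \<mu>}" "0 < c \<mu> k"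
  shows "unbiased_risk m n r c h x < unbiased_risk m n r c (\<lambda>_ _. 0) x"
proof -
  have count_total: "count_total (m \<nu>) (x \<nu>) = 0" if "\<nu> \<in> {1..n}" for \<nu>
    using x [OF that] by (simp add: count_total_def)
  have decrease: "r \<nu> / (r \<nu> + h \<nu> z)\<^sup>2 - 1 / r \<nu> < 0" if "\<nu> \<in> {1..n}" for \<nu> z
  proof -
    have "r \<nu> / (r \<nu> + h \<nu> z)\<^sup>2 < r \<nu> / (r \<nu>)\<^sup>2"
      using r [OF that] h [OF that, of z] by (intro divide_strict_left_mono power_strict_mono) auto
    then show ?thesis using r [OF that] by (simp add: power2_eq_square)
  qed
  have "unbiased_risk m n r c h x - unbiased_risk m n r c (\<lambda>_ _. 0) x
      = (\<Sum>\<nu>=1..n. \<Sum>i=1..m \<nu>. c \<nu> i * (r \<nu> / (r \<nu> + h \<nu> (increment x \<nu> i))\<^sup>2 - 1 / r \<nu>))"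
    unfolding unbiased_risk_diff_umvu using x count_total by (intro sum.cong refl) simp
  also have "\<dots> < (\<Sum>\<nu>=1..n. \<Sum>i=1..m \<nu>. 0)"
  proof (rule sum_strict_mono_ex1)
    have le: "c \<nu> i * (r \<nu> / (r \<nu> + h \<nu> (increment x \<nu> i))\<^sup>2 - 1 / r \<nu>) \<le> 0"
      if "\<nu> \<in> {1..n}" "i \<in> {1..m \<nu>}" for \<nu> i
      using c [OF that] decrease [OF that(1)] by (intro mult_nonneg_nonpos) (auto intro: less_imp_le)
    then show "\<forall>\<nu>\<in>{1..n}. (\<Sum>i=1..m \<nu>. c \<nu> i * (r \<nu> / (r \<nu> + h \<nu> (increment x \<nu> i))\<^sup>2 - 1 / r \<nu>))
        \<le> (\<Sum>i=1..m \<nu>. 0)"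
      by (intro ballI sum_mono)
    have "(\<Sum>i=1..m \<mu>. c \<mu> i * (r \<mu> / (r \<mu> + h \<mu> (increment x \<mu> i))\<^sup>2 - 1 / r \<mu>)) < (\<Sum>i=1..m \<mu>. 0)"
    proof (rule sum_strict_mono_ex1)
      show "\<exists>i\<in>{1..m \<mu>}. c \<mu> i * (r \<mu> / (r \<mu> + h \<mu> (increment x \<mu> i))\<^sup>2 - 1 / r \<mu>) < 0"
        using pos decrease [OF pos(1)] by (intro bexI [OF _ pos(2)]) (auto simp: mult_less_0_iff)
    qed (use le [OF pos(1)] in auto)
    then show "\<exists>\<nu>\<in>{1..n}. (\<Sum>i=1..m \<nu>. c \<nu> i * (r \<nu> / (r \<nu> + h \<nu> (increment x \<nu> i))\<^sup>2 - 1 / r \<nu>))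
        < (\<Sum>i=1..m \<nu>. 0)"
      using pos(1) by blast
  qed simp
  finally show ?thesis by simp
qed

section \<open>Dominance\<close>

definition weighted_total ::
  "nat \<Rightarrow> (nat \<Rightarrow> nat) \<Rightarrow> (nat \<Rightarrow> nat \<Rightarrow> real) \<Rightarrow> (nat \<Rightarrow> nat \<Rightarrow> nat) \<Rightarrow> real" where
  "weighted_total N m w x = (\<Sum>\<nu>=1..N. \<Sum>j=1..m \<nu>. w \<nu> j * real (x \<nu> j))"

lemma weighted_total_increment:
  assumes "\<nu> \<in> {1..N}" "i \<in> {1..m \<nu>}"
  shows "weighted_total N m w (increment x \<nu> i) = weighted_total N m w x + w \<nu> i"
proof -
  have "weighted_total N m w (increment x \<nu> i) - weighted_total N m w x
      = (\<Sum>\<mu>=1..N. \<Sum>j=1..m \<mu>. if \<mu> = \<nu> then if j = i then w \<nu> i else 0 else 0)"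
    unfolding weighted_total_def sum_subtractf [symmetric]
    by (intro sum.cong refl) (auto simp: increment_def algebra_simps)
  also have "\<dots> = (\<Sum>\<mu>=1..N. if \<mu> = \<nu> then \<Sum>j=1..m \<nu>. if j = i then w \<nu> i else 0 else 0)"
    by (intro sum.cong refl) auto
  also have "\<dots> = w \<nu> i" using assms by simp
  finally show ?thesis by simp
qed

lemma weighted_total_mono:
  assumes "\<And>\<nu> j. \<nu> \<in> {1..N} \<Longrightarrow> j \<in> {1..m \<nu>} \<Longrightarrow> v \<nu> j \<le> w \<nu> j"
  shows "weighted_total N m v x \<le> weighted_total N m w x"
  unfolding weighted_total_def using assms by (intro sum_mono mult_right_mono) auto

lemma weighted_total_const: "weighted_total N m (\<lambda>_ _. a) x = a * real (\<Sum>\<nu>=1..N. \<Sum>j=1..m \<nu>. x \<nu> j)"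
  by (simp add: weighted_total_def sum_distrib_left)

lemma param_space_nonempty: "param_space N m \<noteq> {}"
proof -
  have "(\<lambda>\<nu>\<in>{1..N}. \<lambda>i\<in>{1..m \<nu>}. 1 / (real (m \<nu>) + 1)) \<in> param_space N m"
    by (auto simp: param_space_def open_simplex_def divide_simps)
  then show ?thesis by blast
qed

theorem theorem2p2:
  fixes N n :: nat and m :: "nat \<Rightarrow> nat" and r b :: "nat \<Rightarrow> real"
    and c :: "nat \<Rightarrow> nat \<Rightarrow> real" and ct :: "nat \<Rightarrow> nat \<Rightarrow> nat \<Rightarrow> real"
    and M :: "(nat \<Rightarrow> nat \<Rightarrow> real) \<Rightarrow> 'w measure" and X :: "nat \<Rightarrow> 'w \<Rightarrow> nat \<Rightarrow> nat"
    and r_min r_max c_sum_min c_max_max A b_min b_max ct_max_min ct_max_max ct_lo ct_hi \<kappa> :: real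
    and c_sum c_max ct_min ct_max Ct :: "nat \<Rightarrow> real" and \<beta> :: "nat \<Rightarrow> real"
  assumes "N \<ge> 1" and "\<And>\<nu>. \<nu> \<in> {1..N} \<Longrightarrow> m \<nu> \<ge> 1" and "\<And>\<nu>. \<nu> \<in> {1..N} \<Longrightarrow> r \<nu> > 0"
    and model: "neg_multinomial_model N m r M X"
    and "n \<in> {1..N}"
    and "\<And>\<nu> i. \<nu> \<in> {1..N} \<Longrightarrow> i \<in> {1..m \<nu>} \<Longrightarrow> c \<nu> i \<ge> 0"
    and "\<And>\<nu>. \<nu> \<in> {1..N} \<Longrightarrow> b \<nu> > 0"
    and "\<And>\<nu> \<nu>' i. \<nu> \<in> {1..N} \<Longrightarrow> \<nu>' \<in> {1..N} \<Longrightarrow> i \<in> {1..m \<nu>'} \<Longrightarrow> ct \<nu> \<nu>' i > 0"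
    and r_min: "r_min = (MIN \<nu>\<in>{1..n}. r \<nu>)"
    and r_max: "r_max = (MAX \<nu>\<in>{1..n}. r \<nu>)"
    and c_sum: "\<And>\<nu>. \<nu> \<in> {1..N} \<Longrightarrow> c_sum \<nu> = (\<Sum>i=1..m \<nu>. c \<nu> i)"
    and c_sum_min: "c_sum_min = (MIN \<nu>\<in>{1..n}. c_sum \<nu>)"
    and c_max: "\<And>\<nu>. \<nu> \<in> {1..N} \<Longrightarrow> c_max \<nu> = (MAX i\<in>{1..m \<nu>}. c \<nu> i)"
    and c_max_max: "c_max_max = (MAX \<nu>\<in>{1..n}. c_max \<nu>)"
    and ct_min: "\<And>\<nu>. \<nu> \<in> {1..N} \<Longrightarrow> ct_min \<nu> = (MIN i\<in>{1..m \<nu>}. ct \<nu> \<nu> i)"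
    and ct_max: "\<And>\<nu>. \<nu> \<in> {1..N} \<Longrightarrow> ct_max \<nu> = (MAX i\<in>{1..m \<nu>}. ct \<nu> \<nu> i)"
    and Ct: "\<And>\<nu>. \<nu> \<in> {1..N} \<Longrightarrow>
               Ct \<nu> = (ct_max \<nu> / ct_min \<nu>) / (1 + b \<nu> * (ct_min \<nu> + ct_max \<nu>))"
    and A: "A = (MAX \<nu>\<in>{1..n}. c_max \<nu> * (Ct \<nu> + 2))"
    and b_min: "b_min = (MIN \<nu>\<in>{1..n}. b \<nu>)"
    and b_max: "b_max = (MAX \<nu>\<in>{1..n}. b \<nu>)"
    and ct_max_min: "ct_max_min = (MIN \<nu>\<in>{1..n}. ct_max \<nu>)"
    and ct_max_max: "ct_max_max = (MAX \<nu>\<in>{1..n}. ct_max \<nu>)"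
    and ct_lo: "ct_lo = (MIN \<nu>\<in>{1..N}. MIN \<nu>'\<in>{1..N}. MIN i\<in>{1..m \<nu>'}. ct \<nu> \<nu>' i)"
    and ct_hi: "ct_hi = (MAX \<nu>\<in>{1..N}. MAX \<nu>'\<in>{1..N}. MAX i\<in>{1..m \<nu>'}. ct \<nu> \<nu>' i)"
    and \<beta>: "\<And>x. x \<ge> 1 \<Longrightarrow> \<beta> x = b_max + 1 / (ct_lo * real x + ct_max_min)"
    and \<kappa>: "\<kappa> = (b_min * ct_lo * ct_max_min) / (b_max * ct_hi * ct_max_max)"
    and cond_a: "c_max_max > 0"
    and cond_b: "\<And>\<nu>. \<nu> \<in> {1..n} \<Longrightarrow> c_sum \<nu> > 0 \<Longrightarrow> r \<nu> \<ge> Ct \<nu> + 1 \<and> r \<nu> + b \<nu> \<ge> Ct \<nu> + 2"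
    and cond_c: "c_sum_min - A \<ge> 0"
    and cond_d: "\<And>x::nat. x \<ge> 1 \<Longrightarrow>
       ((c_max_max * \<beta> x - 2 * (r_min / r_max)\<^sup>2 * (c_sum_min - A) * \<kappa> \<le> 0 \<longrightarrow>
           c_sum_min * \<beta> x - 2 * (r_min / r_max)\<^sup>2 * (c_sum_min - A) * \<kappa> * (r_min + \<beta> x) \<le> 0) \<and>
        (c_max_max * \<beta> x - 2 * (r_min / r_max)\<^sup>2 * (c_sum_min - A) * \<kappa> > 0 \<longrightarrow>
           real x * (c_max_max * \<beta> x - 2 * (r_min / r_max)\<^sup>2 * (c_sum_min - A) * \<kappa>)
             + real n * c_sum_min * \<beta> x
             - 2 * real n * (r_min / r_max)\<^sup>2 * (c_sum_min - A) * \<kappa> * (r_min + \<beta> x) \<le> 0))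
       \<or>
       ((c_max_max * \<beta> x - 2 * (c_sum_min - A) * \<kappa> \<le> 0 \<longrightarrow>
           (c_sum_min - c_max_max * r_min) - 2 * (c_sum_min - A) * \<kappa> \<le> 0) \<and>
        (c_max_max * \<beta> x - 2 * (c_sum_min - A) * \<kappa> > 0 \<longrightarrow>
           ((\<Sum>\<nu>=1..n. r \<nu>) + real x) * (c_max_max * \<beta> x - 2 * (c_sum_min - A) * \<kappa>)
             + real n * (c_sum_min - c_max_max * r_min) * \<beta> x
             - 2 * real n * (c_sum_min - A) * \<kappa> * \<beta> x \<le> 0))"
  shows "dominates (param_space N m) (risk M X (std_sq_loss m n c))
           (shrinkage_estimator N m r b ct) (umvu_estimator m r)"

proof -
  note N = assms(1) and m = assms(2) and r = assms(3) and n = assms(5) and c = assms(6) and b = assms(7)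
    and ct = assms(8)
  define h where "h \<nu> x = b \<nu> + 1 / weighted_total N m (ct \<nu>) x" for \<nu> x
  have nN: "\<nu> \<in> {1..N}" if "\<nu> \<in> {1..n}" for \<nu> using that n by auto
  have n1: "{1..n} \<noteq> {}" using n by auto
  have m1: "{1..m \<nu>} \<noteq> {}" if "\<nu> \<in> {1..N}" for \<nu> using m [OF that] by auto
  have N1: "{1..N} \<noteq> {}" using N by auto
  have r_b: "r_min \<le> r \<nu>" "r \<nu> \<le> r_max" if "\<nu> \<in> {1..n}" for \<nu> using that by (auto simp: r_min r_max)
  have b_b: "b_min \<le> b \<nu>" "b \<nu> \<le> b_max" if "\<nu> \<in> {1..n}" for \<nu> using that by (auto simp: b_min b_max)
  have cs_b: "c_sum_min \<le> c_sum \<nu>" if "\<nu> \<in> {1..n}" for \<nu> using that by (auto simp: c_sum_min)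
  have cm_b: "c_max \<nu> \<le> c_max_max" if "\<nu> \<in> {1..n}" for \<nu> using that by (auto simp: c_max_max)
  have A_b: "c_max \<nu> * (Ct \<nu> + 2) \<le> A" if "\<nu> \<in> {1..n}" for \<nu> using that by (auto simp: A)
  have q_b: "ct_max_min \<le> ct_max \<nu>" "ct_max \<nu> \<le> ct_max_max" if "\<nu> \<in> {1..n}" for \<nu>
    using that by (auto simp: ct_max_min ct_max_max)
  have c_b: "c \<nu> i \<le> c_max \<nu>" if "\<nu> \<in> {1..N}" "i \<in> {1..m \<nu>}" for \<nu> i
    using that by (auto simp: c_max)
  have ct_b: "ct_min \<nu> \<le> ct \<nu> \<nu> i" "ct \<nu> \<nu> i \<le> ct_max \<nu>" if "\<nu> \<in> {1..N}" "i \<in> {1..m \<nu>}" for \<nu> i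
    using that by (auto simp: ct_min ct_max)
  have lo_b: "ct_lo \<le> ct \<nu> \<nu>' i" and hi_b: "ct \<nu> \<nu>' i \<le> ct_hi"
    if that: "\<nu> \<in> {1..N}" "\<nu>' \<in> {1..N}" "i \<in> {1..m \<nu>'}" for \<nu> \<nu>' i
  proof -
    have "ct_lo \<le> (MIN \<nu>'\<in>{1..N}. MIN i\<in>{1..m \<nu>'}. ct \<nu> \<nu>' i)"
      unfolding ct_lo using that by (intro Min_le) auto
    also have "\<dots> \<le> (MIN i\<in>{1..m \<nu>'}. ct \<nu> \<nu>' i)" using that by (intro Min_le) auto
    also have "\<dots> \<le> ct \<nu> \<nu>' i" using that by (intro Min_le) auto
    finally show "ct_lo \<le> ct \<nu> \<nu>' i" .
    have "ct \<nu> \<nu>' i \<le> (MAX i\<in>{1..m \<nu>'}. ct \<nu> \<nu>' i)" using that by (intro Max_ge) auto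
    also have "\<dots> \<le> (MAX \<nu>'\<in>{1..N}. MAX i\<in>{1..m \<nu>'}. ct \<nu> \<nu>' i)" using that by (intro Max_ge) auto
    also have "\<dots> \<le> ct_hi" unfolding ct_hi using that by (intro Max_ge) auto
    finally show "ct \<nu> \<nu>' i \<le> ct_hi" .
  qed
  have ct_min0: "0 < ct_min \<nu>" if "\<nu> \<in> {1..N}" for \<nu>
    unfolding ct_min [OF that] using m1 [OF that] ct that by (subst Min_gr_iff) auto
  have ct_minmax: "ct_min \<nu> \<le> ct_max \<nu>" if "\<nu> \<in> {1..N}" for \<nu>
    using ct_b [OF that, of 1] m [OF that] by auto
  have ct_max0: "0 < ct_max \<nu>" if "\<nu> \<in> {1..N}" for \<nu>
    using ct_min0 [OF that] ct_minmax [OF that] by linarith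
  have ct_lo0: "0 < ct_lo"
    unfolding ct_lo using N1 m1 ct by (simp add: Min_gr_iff)
  have r_min0: "0 < r_min" unfolding r_min using n1 r nN by (subst Min_gr_iff) auto
  have b_min0: "0 < b_min" unfolding b_min using n1 b nN by (subst Min_gr_iff) auto
  have q_min0: "0 < ct_max_min"
    unfolding ct_max_min using n1 nN ct_max0 by (subst Min_gr_iff) auto
  have one: "1 \<in> {1..n}" using n by auto
  have rr: "r_min \<le> r_max" and bb: "b_min \<le> b_max" and lohi: "ct_lo \<le> ct_hi" and qq: "ct_max_min \<le> ct_max_max"
    using r_b [OF one] b_b [OF one] q_b [OF one] lo_b [of 1 1 1] hi_b [of 1 1 1] N m [of 1] by auto
  have Ct0: "0 < Ct \<nu>" if "\<nu> \<in> {1..N}" for \<nu>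
    unfolding Ct [OF that] using ct_min0 [OF that] ct_minmax [OF that] b [OF that]
    by (intro divide_pos_pos add_pos_nonneg mult_nonneg_nonneg) auto
  \<comment> \<open>A positive weight exists. Hence \<open>A > 0\<close>, so every weight sum is positive and
    hypothesis \<open>cond_b\<close> is available for all populations up to \<open>n\<close>.\<close>
  obtain \<mu> where \<mu>: "\<mu> \<in> {1..n}" "c_max_max = c_max \<mu>"
  proof -
    have "c_max_max \<in> c_max ` {1..n}" unfolding c_max_max using n1 by (intro Max_in) auto
    then show ?thesis using that by auto
  qed
  obtain k where "k \<in> {1..m \<mu>}" "c_max \<mu> = c \<mu> k"
  proof -
    have "c_max \<mu> \<in> c \<mu> ` {1..m \<mu>}"
      unfolding c_max [OF nN [OF \<mu>(1)]] using m1 [OF nN [OF \<mu>(1)]] by (intro Max_in) auto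
    then show ?thesis using that by auto
  qed
  then have pos: "\<mu> \<in> {1..n}" "k \<in> {1..m \<mu>}" "0 < c \<mu> k" using \<mu> cond_a by auto
  have A0: "0 < A"
  proof -
    have "0 < c_max \<mu> * (Ct \<mu> + 2)" using Ct0 [OF nN [OF \<mu>(1)]] cond_a \<mu>(2) by (intro mult_pos_pos) auto
    then show ?thesis using A_b [OF \<mu>(1)] by linarith
  qed
  have cs0: "0 < c_sum \<nu>" if "\<nu> \<in> {1..n}" for \<nu> using cs_b [OF that] cond_c A0 by linarith
  have rb: "Ct \<nu> + 1 \<le> r \<nu>" "Ct \<nu> + 2 \<le> r \<nu> + b \<nu>" if "\<nu> \<in> {1..n}" for \<nu>
    using cond_b [OF that cs0 [OF that]] by auto
  have r1: "1 < r \<nu>" if "\<nu> \<in> {1..n}" for \<nu> using rb [OF that] Ct0 [OF nN [OF that]] by linarith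
  have \<kappa>0: "0 < \<kappa>"
    unfolding \<kappa> using b_min0 bb ct_lo0 lohi q_min0 qq by (intro divide_pos_pos mult_pos_pos) auto
  have wt0: "0 \<le> weighted_total N m (ct \<nu>) x" if "\<nu> \<in> {1..N}" for \<nu> x
    unfolding weighted_total_def using ct [OF that] by (intro sum_nonneg mult_nonneg_nonneg) (auto intro: less_imp_le)
  have h0: "0 \<le> h \<nu> x" "0 < h \<nu> x" if "\<nu> \<in> {1..n}" for \<nu> x
    using wt0 [OF nN [OF that], of x] b [OF nN [OF that]] by (auto simp: h_def add_pos_nonneg less_imp_le)

  have less_at_zero: "unbiased_risk m n r c h x < unbiased_risk m n r c (\<lambda>_ _. 0) x"
    if "\<And>\<nu> i. \<nu> \<in> {1..n} \<Longrightarrow> i \<in> {1..m \<nu>} \<Longrightarrow> x \<nu> i = 0" for x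
    by (rule unbiased_risk_less_umvu_at_zero [where \<mu> = \<mu> and k = k]) (use that pos r c nN h0 in auto)
  have le: "unbiased_risk m n r c h x \<le> unbiased_risk m n r c (\<lambda>_ _. 0) x"
    for x
  proof -
    \<comment> \<open>\<open>K\<close> counts over all \<open>N\<close> populations, as \<open>weighted_total\<close> does, and is the point at which
      \<open>cond_d\<close> is applied.\<close>
    define K where "K = (\<Sum>\<nu>=1..N. \<Sum>j=1..m \<nu>. x \<nu> j)"
    define y where "y \<nu> = count_total (m \<nu>) (x \<nu>)" for \<nu>
    define X where "X \<nu> = weighted_total N m (ct \<nu>) x" for \<nu>
    define \<psi> where "\<psi> \<nu> = b \<nu> + 1 / (X \<nu> + ct_max \<nu>)" for \<nu>
    have y0: "0 \<le> y \<nu>" for \<nu> using count_total_nonneg by (simp add: y_def)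
    have yK: "(\<Sum>\<nu>=1..n. y \<nu>) \<le> real K"
    proof -
      have "(\<Sum>\<nu>=1..n. y \<nu>) \<le> (\<Sum>\<nu>=1..N. y \<nu>)" using n y0 by (intro sum_mono2) auto
      also have "\<dots> = real K" by (simp add: y_def K_def count_total_def)
      finally show ?thesis .
    qed
    have X_b: "0 \<le> X \<nu>" "ct_lo * real K \<le> X \<nu>" "X \<nu> \<le> ct_hi * real K" "ct_min \<nu> * y \<nu> \<le> X \<nu>"
      if \<nu>: "\<nu> \<in> {1..n}" for \<nu>
    proof -
      note \<nu>' = nN [OF \<nu>]
      show "0 \<le> X \<nu>" using wt0 [OF \<nu>'] by (simp add: X_def)
      show "ct_lo * real K \<le> X \<nu>"
        using weighted_total_mono [of N m "\<lambda>_ _. ct_lo" "ct \<nu>" x] lo_b [OF \<nu>']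
        unfolding weighted_total_const X_def K_def by blast
      show "X \<nu> \<le> ct_hi * real K"
        using weighted_total_mono [of N m "ct \<nu>" "\<lambda>_ _. ct_hi" x] hi_b [OF \<nu>']
        unfolding weighted_total_const X_def K_def by blast
      have "ct_min \<nu> * y \<nu> \<le> (\<Sum>j=1..m \<nu>. ct \<nu> \<nu> j * real (x \<nu> j))"
        unfolding y_def count_total_def sum_distrib_left using ct_b [OF \<nu>'] by (intro sum_mono mult_right_mono) auto
      also have "\<dots> \<le> X \<nu>"
        unfolding X_def weighted_total_def using \<nu>' ct [OF \<nu>']
        by (intro member_le_sum [of \<nu> "{1..N}" "\<lambda>\<nu>'. \<Sum>j=1..m \<nu>'. ct \<nu> \<nu>' j * real (x \<nu>' j)"] sum_nonneg mult_nonneg_nonneg)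
          (auto intro: less_imp_le)
      finally show "ct_min \<nu> * y \<nu> \<le> X \<nu>" .
    qed
    have q0: "0 < ct_max \<nu>" if "\<nu> \<in> {1..n}" for \<nu> using q_b [OF that] q_min0 by linarith
    have \<psi>_b: "b \<nu> \<le> \<psi> \<nu>" "0 < \<psi> \<nu>" if "\<nu> \<in> {1..n}" for \<nu>
      using X_b [OF that] q0 [OF that] b [OF nN [OF that]] by (auto simp: \<psi>_def intro!: add_pos_nonneg)
    have h_inc: "\<psi> \<nu> \<le> h \<nu> (increment x \<nu> i)" if \<nu>: "\<nu> \<in> {1..n}" and i: "i \<in> {1..m \<nu>}" for \<nu> i
    proof -
      have "h \<nu> (increment x \<nu> i) = b \<nu> + 1 / (X \<nu> + ct \<nu> \<nu> i)"
        using weighted_total_increment [of \<nu> N i m "ct \<nu>" x] nN [OF \<nu>] i by (simp add: h_def X_def)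
      then show ?thesis
        using X_b(1) [OF \<nu>] ct_b(2) [OF nN [OF \<nu>] i] ct [OF nN [OF \<nu>] nN [OF \<nu>] i]
        by (auto simp: \<psi>_def intro!: divide_left_mono mult_pos_pos add_nonneg_pos)
    qed
    have h_x: "\<psi> \<nu> \<le> h \<nu> x \<and> h \<nu> x \<le> \<psi> \<nu> * (1 + Ct \<nu> / y \<nu>)" if \<nu>: "\<nu> \<in> {1..n}" and y: "0 < y \<nu>" for \<nu>
    proof
      note \<nu>' = nN [OF \<nu>]
      have y1: "1 \<le> y \<nu>" using y unfolding y_def count_total_def of_nat_sum [symmetric] by (simp del: of_nat_sum)
      have "0 < ct_min \<nu> * y \<nu>" using y ct_min0 [OF \<nu>'] by simp
      then have X0: "0 < X \<nu>" using X_b(4) [OF \<nu>] by linarith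
      have hX: "h \<nu> x = b \<nu> + 1 / X \<nu>" by (simp add: h_def X_def)
      show "\<psi> \<nu> \<le> h \<nu> x" unfolding hX \<psi>_def using X0 q0 [OF \<nu>] by (intro add_left_mono divide_left_mono) auto
      show "h \<nu> x \<le> \<psi> \<nu> * (1 + Ct \<nu> / y \<nu>)"
        unfolding hX \<psi>_def Ct [OF \<nu>']
        by (rule inverse_affine_ratio) (use b [OF \<nu>'] ct_min0 [OF \<nu>'] ct_minmax [OF \<nu>'] y1 X_b(4) [OF \<nu>] in auto)
    qed
    have bound: "unbiased_risk m n r c h x - unbiased_risk m n r c (\<lambda>_ _. 0) x
       \<le> (\<Sum>\<nu>=1..n. \<psi> \<nu> / ((r \<nu> + y \<nu>) * (r \<nu> + y \<nu> + \<psi> \<nu>))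
            * ((c_max_max * y \<nu> + c_sum_min) * (\<psi> \<nu> / (r \<nu> + y \<nu> + \<psi> \<nu>)) - 2 * (c_sum_min - A)))"
      unfolding unbiased_risk_diff_umvu y_def [symmetric]
    proof (rule sum_mono)
      fix \<nu> assume \<nu>: "\<nu> \<in> {1..n}"
      note \<nu>' = nN [OF \<nu>]
      show "(\<Sum>i=1..m \<nu>. c \<nu> i * ((real (x \<nu> i) + 1) * ((r \<nu> + y \<nu>) / (r \<nu> + y \<nu> + h \<nu> (increment x \<nu> i))\<^sup>2
                - 1 / (r \<nu> + y \<nu>))
              + 2 * real (x \<nu> i) * (1 / (r \<nu> + y \<nu> - 1) - 1 / (r \<nu> + y \<nu> - 1 + h \<nu> x))))
         \<le> \<psi> \<nu> / ((r \<nu> + y \<nu>) * (r \<nu> + y \<nu> + \<psi> \<nu>))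
            * ((c_max_max * y \<nu> + c_sum_min) * (\<psi> \<nu> / (r \<nu> + y \<nu> + \<psi> \<nu>)) - 2 * (c_sum_min - A))"
      proof (rule population_bound [where C = "Ct \<nu>" and b = "b \<nu>" and cmax = "c_max \<nu>" and r = "r \<nu>"])
        show "c_sum_min \<le> (\<Sum>i=1..m \<nu>. c \<nu> i)" using cs_b [OF \<nu>] c_sum [OF \<nu>'] by simp
      qed (use c [OF \<nu>'] c_b [OF \<nu>'] rb [OF \<nu>] less_imp_le [OF Ct0 [OF \<nu>']] \<psi>_b [OF \<nu>] h_inc [OF \<nu>] h_x [OF \<nu>]
            cm_b [OF \<nu>] A_b [OF \<nu>] A0 in \<open>auto simp: y_def count_total_def\<close>)
    qed
    show ?thesis
    proof (cases "K = 0")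
      case True
      then have "x \<nu> i = 0" if "\<nu> \<in> {1..n}" "i \<in> {1..m \<nu>}" for \<nu> i
        using that nN [OF that(1)] unfolding K_def by simp
      then show ?thesis by (intro less_imp_le less_at_zero)
    next
      case False
      have K1: "1 \<le> K" using False by simp
      have \<beta>K: "\<beta> K = b_max + 1 / (ct_lo * real K + ct_max_min)" using \<beta> [OF K1] .
      have lK: "0 < ct_lo * real K" using K1 ct_lo0 by simp
      have "(\<Sum>\<nu>=1..n. \<psi> \<nu> / ((r \<nu> + y \<nu>) * (r \<nu> + y \<nu> + \<psi> \<nu>))
            * ((c_max_max * y \<nu> + c_sum_min) * (\<psi> \<nu> / (r \<nu> + y \<nu> + \<psi> \<nu>)) - 2 * (c_sum_min - A))) \<le> 0"
      proof (rule reduced_sum_nonpos [where x = "real K" and \<kappa> = \<kappa> and \<beta> = "\<beta> K" and r_min = r_min and r_max = r_max])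
        show "0 < \<beta> K" unfolding \<beta>K using b_min0 bb lK q_min0 by (intro add_pos_pos) auto
        fix \<nu> assume \<nu>: "\<nu> \<in> {1..n}"
        show "\<kappa> * \<beta> K \<le> \<psi> \<nu>"
          unfolding \<kappa> \<beta>K \<psi>_def
          by (rule shrinkage_term_ge) (use b_min0 b_b [OF \<nu>] bb ct_lo0 lohi q_min0 q_b [OF \<nu>] X_b [OF \<nu>] in auto)
        show "\<psi> \<nu> \<le> \<beta> K"
          unfolding \<psi>_def \<beta>K using b_b [OF \<nu>] X_b [OF \<nu>] q_b [OF \<nu>] q_min0 lK
          by (intro add_mono divide_left_mono mult_pos_pos) auto
      next
        show "0 \<le> c_sum_min" using cond_c A0 by linarith
      next
        show "((c_max_max * \<beta> K - 2 * (r_min / r_max)\<^sup>2 * (c_sum_min - A) * \<kappa> \<le> 0 \<longrightarrow>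
           c_sum_min * \<beta> K - 2 * (r_min / r_max)\<^sup>2 * (c_sum_min - A) * \<kappa> * (r_min + \<beta> K) \<le> 0) \<and>
        (c_max_max * \<beta> K - 2 * (r_min / r_max)\<^sup>2 * (c_sum_min - A) * \<kappa> > 0 \<longrightarrow>
           real K * (c_max_max * \<beta> K - 2 * (r_min / r_max)\<^sup>2 * (c_sum_min - A) * \<kappa>)
             + real (card {1..n}) * c_sum_min * \<beta> K
             - 2 * real (card {1..n}) * (r_min / r_max)\<^sup>2 * (c_sum_min - A) * \<kappa> * (r_min + \<beta> K) \<le> 0))
       \<or>
       ((c_max_max * \<beta> K - 2 * (c_sum_min - A) * \<kappa> \<le> 0 \<longrightarrow>
           (c_sum_min - c_max_max * r_min) - 2 * (c_sum_min - A) * \<kappa> \<le> 0) \<and>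
        (c_max_max * \<beta> K - 2 * (c_sum_min - A) * \<kappa> > 0 \<longrightarrow>
           ((\<Sum>\<nu>=1..n. r \<nu>) + real K) * (c_max_max * \<beta> K - 2 * (c_sum_min - A) * \<kappa>)
             + real (card {1..n}) * (c_sum_min - c_max_max * r_min) * \<beta> K
             - 2 * real (card {1..n}) * (c_sum_min - A) * \<kappa> * \<beta> K \<le> 0))"
          using cond_d [OF K1] by (simp only: card_atLeastAtMost diff_Suc_1 add_diff_cancel_right' Suc_eq_plus1)
      qed (use r_min0 r_b rr y0 yK \<kappa>0 cond_a cond_c in auto)
      then show ?thesis using bound by linarith
    qed
  qed
  have shrink: "shrinkage_estimator N m r b ct x \<nu> i = real (x \<nu> i) / (r \<nu> + count_total (m \<nu>) (x \<nu>) - 1 + h \<nu> x)" for x \<nu> i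
    by (simp add: shrinkage_estimator_def h_def count_total_def weighted_total_def add.assoc)
  have umvu: "umvu_estimator m r x \<nu> i = real (x \<nu> i) / (r \<nu> + count_total (m \<nu>) (x \<nu>) - 1 + 0)" for x \<nu> i
    by (simp add: umvu_estimator_def count_total_def)
  let ?cp = "\<lambda>p. \<Sum>\<nu>=1..n. \<Sum>i=1..m \<nu>. c \<nu> i * p \<nu> i"
  have risks: "risk M X (std_sq_loss m n c) (shrinkage_estimator N m r b ct) p
        < risk M X (std_sq_loss m n c) (umvu_estimator m r) p"
    if p: "p \<in> param_space N m" for p
  proof -
    let ?Q = "joint_law N m r p"
    interpret prob_space ?Q by (rule prob_space_joint_law [OF model p r N])
    have J: "0 < joint_mass N m r p x" for x by (rule joint_mass_pos [OF p r])
    have dep_s: "std_sq_loss m n c (shrinkage_estimator N m r b ct (restrict x {1..N})) p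
        = std_sq_loss m n c (shrinkage_estimator N m r b ct x) p" for x
      unfolding std_sq_loss_def shrinkage_estimator_def using nN by (intro sum.cong refl) simp
    have dep_u: "std_sq_loss m n c (umvu_estimator m r (restrict x {1..N})) p
        = std_sq_loss m n c (umvu_estimator m r x) p" for x
      unfolding std_sq_loss_def umvu_estimator_def using nN by (intro sum.cong refl) simp
    have nle: "n \<le> N" using n by simp
    have c': "0 \<le> c \<nu> i" if "\<nu> \<in> {1..n}" "i \<in> {1..m \<nu>}" for \<nu> i using c nN that by blast
    note S = expected_loss_eq_unbiased_risk [where h = h and \<delta> = "shrinkage_estimator N m r b ct",
        OF prob_space_axioms p r nle r1 h0(1) c' shrink]
    note U = expected_loss_eq_unbiased_risk [where h = "\<lambda>_ _. 0" and \<delta> = "umvu_estimator m r",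
        OF prob_space_axioms p r nle r1 order_refl c' umvu]
    let ?z = "\<lambda>\<nu>\<in>{1..N}. \<lambda>i\<in>{1..m \<nu>}. 0 :: nat"
    have z: "?z \<in> sample_space N m" by (auto simp: sample_space_def count_vectors_def)
    have "(\<integral>x. unbiased_risk m n r c h x \<partial>?Q) < (\<integral>x. unbiased_risk m n r c (\<lambda>_ _. 0) x \<partial>?Q)"
    proof (rule integral_less_AE [where A = "{?z}", OF S(1) U(1)])
      have "emeasure ?Q {?z} = ennreal (joint_mass N m r p ?z)"
        unfolding joint_law_def using z by (simp add: emeasure_density nn_integral_indicator_singleton)
      then show "emeasure ?Q {?z} \<noteq> 0" using J [of ?z] by (simp del: restrict_apply)
      show "{?z} \<in> sets ?Q" using z by (simp add: joint_law_def)
      have "unbiased_risk m n r c h ?z < unbiased_risk m n r c (\<lambda>_ _. 0) ?z"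
        by (rule less_at_zero) (use nN in auto)
      then show "AE x in ?Q. x \<in> {?z} \<longrightarrow> unbiased_risk m n r c h x \<noteq> unbiased_risk m n r c (\<lambda>_ _. 0) x"
        by auto
      show "AE x in ?Q. unbiased_risk m n r c h x \<le> unbiased_risk m n r c (\<lambda>_ _. 0) x" using le by simp
    qed
    then have "(\<integral>x. unbiased_risk m n r c h x \<partial>?Q) + ?cp p < (\<integral>x. unbiased_risk m n r c (\<lambda>_ _. 0) x \<partial>?Q) + ?cp p"
      by simp
    moreover have "risk M X (std_sq_loss m n c) (shrinkage_estimator N m r b ct) p
        = (\<integral>\<^sup>+ x. ennreal (std_sq_loss m n c (shrinkage_estimator N m r b ct x) p) \<partial>?Q)"
      by (rule risk_eq_nn_integral_joint_law [OF model p]; fact)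
    moreover have "risk M X (std_sq_loss m n c) (umvu_estimator m r) p
        = (\<integral>\<^sup>+ x. ennreal (std_sq_loss m n c (umvu_estimator m r x) p) \<partial>?Q)"
      by (rule risk_eq_nn_integral_joint_law [OF model p]; fact)
    ultimately show ?thesis using S(2,3) U(2) by (simp add: ennreal_less_iff)
  qed
  then show ?thesis
    unfolding dominates_def using param_space_nonempty [of N m] by (auto intro: less_imp_le)
qed

end
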